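(* Let $n,k,l$ be positive integers with $\gcd(k,l)=1$, $n\nmid k$ and $n\nmid l$. Then the Jacobian group $\mathrm{Jac}(I(n,k,l))$ of the $I$-graph $I(n,k,l)$ is isomorphic to the torsion subgroup of $\operatorname{coker}(\mathcal{A}^{n}-I)$, where $\mathcal{A}$ is the companion matrix of the Laurent polynomial $(3-z^{k}-z^{-k})(3-z^{l}-z^{-l})-1$ and $I$ is the identity matrix of order $2(k+l)$.
   Context: The $I$-graph $I(n,k,l)$ is the multigraph with vertex set $\{u_i,v_i : i\in\mathbb{Z}/n\}$ and with edges $u_iu_{i+l}$, $u_iv_i$, $v_iv_{i+k}$, one of each kind for every $i\in\mathbb{Z}/n$ (subscripts modulo $n$; $3n$ edges in total). Multiple edges are allowed, and the graph is $3$-valent; the conditions $n\nmid k$, $n\nmid l$ say there are no loops. Jacobian group: let $G$ be a connected finite loopless multigraph, and let $O$ be the set of its directed edges (each edge taken with both directions), with initial and terminal vertices $s(e),t(e)$. A closed directed path is a sequence $e_1,\dots,e_r\in O$ with $t(e_i)=s(e_{i+1})$ for $1\le i<r$ and $t(e_r)=s(e_1)$. $\mathrm{Jac}(G)$ is the abelian group generated by symbols $\omega(e)$, $e\in O$, subject to the relations: (K1) $\sum_{e\in O,\,t(e)=x}\omega(e)=0$ for every vertex $x$; (K2) $\sum_{e\in W}\omega(e)=0$ for every closed directed path $W$. Equivalently (well-known), $\mathrm{Jac}(G)$ is the torsion subgroup of $\operatorname{coker}L(G)=\mathbb{Z}^{|V(G)|}/\operatorname{im}L(G)$, where $L(G)=D(G)-A(G)$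 is the Laplacian matrix (degree matrix minus adjacency matrix counting edges with multiplicity). For an integer $m\times m$ matrix $M$, $\operatorname{coker}M=\mathbb{Z}^m/\operatorname{im}M$. For a bimonic integer Laurent polynomial $P(z)=z^p+a_1z^{p+1}+\cdots+a_{s-1}z^{p+s-1}+z^{p+s}$ (with $p,a_1,\dots,a_{s-1}\in\mathbb{Z}$, $s\ge 1$), its companion matrix is the $s\times s$ matrix whose first $s-1$ rows are $(0\mid I_{s-1})$ (a zero column followed by the identity matrix of order $s-1$) and whose last row is $(-1,-a_1,\dots,-a_{s-1})$. The Laurent polynomial $(3-z^{k}-z^{-k})(3-z^{l}-z^{-l})-1$ is bimonic with $p=-(k+l)$, $s=2(k+l)$. *)

theory Defs
  imports
    "HOL-Algebra.Free_Abelian_Groups"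
    "Jordan_Normal_Form.Matrix"
    "Graph_Theory.Digraph"
    "Graph_Theory.Arc_Walk"
begin

text \<open>
  A finite undirected multigraph is encoded as a \<^typ>\<open>('a, 'b) pre_digraph\<close> with exactly one arc
  per undirected edge; the orientation of that arc is arbitrary and carries no meaning.
  The arc set of \<open>bidirect G\<close> is the set of directed edges: each edge occurs once in either
  direction, the flag being \<^const>\<open>True\<close> for the reference orientation.
\<close>

definition bidirect :: "('a, 'b) pre_digraph \<Rightarrow> ('a, 'b \<times> bool) pre_digraph" where
  "bidirect G = \<lparr>
     verts = verts G,
     arcs = arcs G \<times> UNIV,
     tail = (\<lambda>(e, d). if d then tail G e else head G e),
     head = (\<lambda>(e, d). if d then head G e else tail G e)\<rparr>"

definition vertex_relations :: "('a, 'b) pre_digraph \<Rightarrow> (('b \<times> bool) \<Rightarrow>\<^sub>0 int) set" where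
  "vertex_relations G =
     {\<Sum>e \<in> {e \<in> arcs (bidirect G). head (bidirect G) e = x}. frag_of e | x. x \<in> verts G}"

text \<open>A closed walk may repeat directed edges; each occurrence contributes to the sum.\<close>

definition cycle_relations :: "('a, 'b) pre_digraph \<Rightarrow> (('b \<times> bool) \<Rightarrow>\<^sub>0 int) set" where
  "cycle_relations G = {\<Sum>e\<leftarrow>w. frag_of e | w. w \<noteq> [] \<and>
     (\<exists>x. pre_digraph.awalk (bidirect G) x w x)}"

definition Jac :: "('a, 'b) pre_digraph \<Rightarrow> (('b \<times> bool) \<Rightarrow>\<^sub>0 int) set monoid" where
  "Jac G = (let F = free_Abelian_group (arcs (bidirect G))
            in F Mod generate F (vertex_relations G \<union> cycle_relations G))"

text \<open>The residues modulo \<open>n\<close> are represented by \<open>{0..<n}\<close>.\<close>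

datatype I_vertex = U nat | V nat

datatype I_edge = UU nat | UV nat | VV nat

definition I_graph :: "nat \<Rightarrow> nat \<Rightarrow> nat \<Rightarrow> (I_vertex, I_edge) pre_digraph" where
  "I_graph n k l = \<lparr>
     verts = U ` {0..<n} \<union> V ` {0..<n},
     arcs = UU ` {0..<n} \<union> UV ` {0..<n} \<union> VV ` {0..<n},
     tail = (\<lambda>e. case e of UU i \<Rightarrow> U i | UV i \<Rightarrow> U i | VV i \<Rightarrow> V i),
     head = (\<lambda>e. case e of UU i \<Rightarrow> U ((i + l) mod n) | UV i \<Rightarrow> V i | VV i \<Rightarrow> V ((i + k) mod n))\<rparr>"

definition torsion_subgroup :: "('a, 'b) monoid_scheme \<Rightarrow> ('a, 'b) monoid_scheme" where
  "torsion_subgroup G =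
     G\<lparr>carrier := {x \<in> carrier G. \<exists>m::nat. m > 0 \<and> x [^]\<^bsub>G\<^esub> m = \<one>\<^bsub>G\<^esub>}\<rparr>"

definition coker :: "int mat \<Rightarrow> int vec set monoid" where
  "coker M = monoid_vec TYPE(int) (dim_row M) Mod ((\<lambda>v. M *\<^sub>v v) ` carrier_vec (dim_col M))"

text \<open>
  Integer Laurent polynomials are the elements of the group ring of the additive group of
  integers, i.e. finitely supported functions from exponents to coefficients with convolution
  product.
\<close>

type_synonym laurent_poly = "int \<Rightarrow>\<^sub>0 int"

abbreviation zpow :: "int \<Rightarrow> laurent_poly" where
  "zpow i \<equiv> Poly_Mapping.single i 1"

definition low_exp :: "laurent_poly \<Rightarrow> int" where
  "low_exp P = Min (Poly_Mapping.keys P)"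

definition high_exp :: "laurent_poly \<Rightarrow> int" where
  "high_exp P = Max (Poly_Mapping.keys P)"

definition bimonic :: "laurent_poly \<Rightarrow> bool" where
  "bimonic P \<longleftrightarrow> low_exp P < high_exp P \<and>
     Poly_Mapping.lookup P (low_exp P) = 1 \<and> Poly_Mapping.lookup P (high_exp P) = 1"

text \<open>
  Only meaningful for bimonic \<open>P\<close>. In the last row, the entry in column \<open>0\<close> is \<open>-1\<close> because the
  lowest coefficient of \<open>P\<close> is \<open>1\<close>.
\<close>

definition companion_mat :: "laurent_poly \<Rightarrow> int mat" where
  "companion_mat P = (let p = low_exp P; s = nat (high_exp P - low_exp P) in
     mat s s (\<lambda>(i, j).
       if i < s - 1 then (if j = i + 1 then 1 else 0)
       else - Poly_Mapping.lookup P (p + int j)))"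

definition I_poly :: "nat \<Rightarrow> nat \<Rightarrow> laurent_poly" where
  "I_poly k l = (3 - zpow (int k) - zpow (- int k)) * (3 - zpow (int l) - zpow (- int l)) - 1"

lemma lookup_I_poly:
  "Poly_Mapping.lookup (I_poly k l) i =
     (8 when 0 = i)
     - 3 * ((1 when int k = i) + (1 when - int k = i) + (1 when int l = i) + (1 when - int l = i))
     + (1 when int k + int l = i) + (1 when int k - int l = i)
     + (1 when int l - int k = i) + (1 when - int k - int l = i)"
proof -
  have 1: "(x - a - b) * (x - c - d) - 1 = (x * x - 1) - (x * a + x * b + x * c + x * d)
     + a * c + a * d + c * b + b * d" for a b c d x :: laurent_poly
    by (simp add: algebra_simps)
  have 2: "3 * p = Poly_Mapping.single 0 3 * p" for p :: laurent_poly
    by simp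
  have 3: "(3::laurent_poly) * 3 - 1 = Poly_Mapping.single 0 8"
    by simp
  have 4: "3 * ((1::int) when b) = (3 when b)" for b
    by (simp add: when_def)
  show ?thesis
    unfolding I_poly_def 1 3 unfolding 2 Poly_Mapping.mult_single
    by (simp only: lookup_add lookup_minus lookup_single distrib_left 4 mult_1_left mult_1_right
      add_0_left add_0_right diff_conv_add_uminus add.assoc [symmetric] mult.commute [of _ "3::laurent_poly"])
       (simp only: 2 Poly_Mapping.mult_single lookup_single lookup_add lookup_uminus add_0_left
        mult_1_right ac_simps)
qed

lemma
  assumes "k > 0" "l > 0"
  shows low_exp_I_poly: "low_exp (I_poly k l) = - int (k + l)"
    and high_exp_I_poly: "high_exp (I_poly k l) = int (k + l)"
    and bimonic_I_poly: "bimonic (I_poly k l)"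
proof -
  have *: "Poly_Mapping.lookup (I_poly k l) (- int (k + l)) = 1"
          "Poly_Mapping.lookup (I_poly k l) (int (k + l)) = 1"
  proof -
    define K L where "K = int k" and "L = int l"
    have "K > 0" "L > 0"
      using assms by (simp_all add: K_def L_def)
    then show "Poly_Mapping.lookup (I_poly k l) (- int (k + l)) = 1"
      "Poly_Mapping.lookup (I_poly k l) (int (k + l)) = 1"
      unfolding lookup_I_poly of_nat_add K_def [symmetric] L_def [symmetric]
      by (auto simp: when_def)
  qed
  then have mem: "- int (k + l) \<in> Poly_Mapping.keys (I_poly k l)"
                 "int (k + l) \<in> Poly_Mapping.keys (I_poly k l)"
    by (simp_all only: in_keys_iff)
  have bd: "- int (k + l) \<le> i \<and> i \<le> int (k + l)" if "i \<in> Poly_Mapping.keys (I_poly k l)" for i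
  proof (rule ccontr)
    assume "\<not> ?thesis"
    then have "0 \<noteq> i" "int k \<noteq> i" "- int k \<noteq> i" "int l \<noteq> i" "- int l \<noteq> i" "int k + int l \<noteq> i"
      "int k - int l \<noteq> i" "int l - int k \<noteq> i" "- int k - int l \<noteq> i"
      by linarith+
    with that show False
      by (simp add: in_keys_iff lookup_I_poly)
  qed
  show low: "low_exp (I_poly k l) = - int (k + l)"
    unfolding low_exp_def using mem bd by (intro Min_eqI) auto
  show high: "high_exp (I_poly k l) = int (k + l)"
    unfolding high_exp_def using mem bd by (intro Max_eqI) auto
  show "bimonic (I_poly k l)"
    unfolding bimonic_def low high
    by (intro conjI *) (use assms in linarith)
qed

lemma companion_mat_I_poly_carrier:
  assumes "k > 0" "l > 0"
  shows "companion_mat (I_poly k l) \<in> carrier_mat (2 * (k + l)) (2 * (k + l))"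
proof -
  have "nat (int (k + l) - - int (k + l)) = 2 * (k + l)"
    by simp
  then show ?thesis
    unfolding companion_mat_def Let_def low_exp_I_poly[OF assms] high_exp_I_poly[OF assms]
    by (simp only: mat_carrier)
qed

end

theory Submission
  imports
    Defs
    "HOL-Computational_Algebra.Formal_Power_Series"
    "Jordan_Normal_Form.Determinant"
begin

text \<open>
  Write \<open>z\<close> for \<open>zpow 1\<close> and \<open>P\<close> for \<open>I_poly k l\<close>.  Both groups embed into the additive group of the
  ring \<open>R\<close> of Laurent polynomials modulo \<open>z\<close> to the power \<open>n\<close> minus \<open>1\<close> and \<open>P\<close>, with the same image.

  On the side of the graph, send a directed edge to the difference of its end points.  This
  kills closed walks, and by connectedness identifies the Jacobian group with the divisors of
  degree zero modulo the image of the Laplacian.  The Laplacian relation at the vertex \<open>U i\<close> is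
  solved by \<open>V i = laplace l * U i\<close>, and then the relation at \<open>V i\<close> says that \<open>P\<close> kills \<open>U i\<close>.
  So divisors modulo the Laplacian are \<open>R\<close>, with the power \<open>i\<close> of \<open>z\<close> for the vertex \<open>U i\<close>, and
  the degree is the value at \<open>z = 1\<close>, called \<open>aug\<close> here; it is well defined on \<open>R\<close> as \<open>P\<close> vanishes
  at \<open>1\<close>.  The lemmas \<open>boundary_in_ideal_imp_relator\<close> and \<open>boundary_surj\<close> show that the Jacobian
  group is the subgroup of \<open>R\<close> where \<open>aug\<close> vanishes.

  On the side of the matrix, the companion matrix acts as a shift on windows of length
  \<open>2 * (k + l)\<close> of integer sequences \<open>x\<close> with \<open>P \<star> x = 0\<close>.  The module of these sequences is free of
  rank one over the Laurent polynomials modulo \<open>P\<close>, generated by the difference of the two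
  expansions of \<open>1 / P\<close>, in \<open>z\<close> and in \<open>1 / z\<close> (\<open>annihilator_impulse\<close>, \<open>window_surj\<close>).  Hence the cokernel
  is \<open>R\<close> (\<open>impulse_window_in_image_iff\<close>).  The generator is needed because multiplication by \<open>z\<close> on
  the basis of powers of \<open>z\<close> has the transpose of the companion matrix.

  It remains to see that an element of \<open>R\<close> is torsion if and only if \<open>aug\<close> vanishes on it
  (\<open>torsion_iff\<close>).  This amounts to the fact that the periodic solutions of \<open>P \<star> x = 0\<close> are constant,
  which is the maximum principle for harmonic functions on a connected graph
  (\<open>I_poly_harmonic\<close>).
\<close>

section \<open>Convolution of Laurent polynomials with sequences\<close>

lemma laurent_induct [case_names zero zpow diff]:
  fixes f :: laurent_poly
  assumes "Q 0" and "\<And>i. Q (zpow i)" and "\<And>a b. Q a \<Longrightarrow> Q b \<Longrightarrow> Q (a - b)"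
  shows "Q f"
  using frag_induction[of f UNIV Q] assms by auto

lemma zpow_mult [simp]: "zpow i * zpow j = zpow (i + j)"
  by (simp add: Poly_Mapping.mult_single)

text \<open>
  Sequences indexed by the integers form a module over the Laurent polynomials, with \<open>zpow 1\<close>
  acting as the shift to the right.  Finitely supported sequences are the Laurent polynomials
  themselves, and on them the action is multiplication (\<open>conv_lookup\<close> below).
\<close>

definition conv :: "laurent_poly \<Rightarrow> (int \<Rightarrow> int) \<Rightarrow> int \<Rightarrow> int" (infixr "\<star>" 70) where
  "(f \<star> x) i = (\<Sum>j\<in>Poly_Mapping.keys f. Poly_Mapping.lookup f j * x (i - j))"

lemma conv_superset:
  assumes "finite S" "Poly_Mapping.keys f \<subseteq> S"
  shows "(f \<star> x) i = (\<Sum>j\<in>S. Poly_Mapping.lookup f j * x (i - j))"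
  unfolding conv_def
  by (rule sum.mono_neutral_left) (use assms in \<open>auto simp: in_keys_iff\<close>)

lemma conv_zero_left [simp]: "0 \<star> x = (\<lambda>_. 0)"
  by (simp add: conv_def fun_eq_iff)

lemma conv_zpow [simp]: "zpow j \<star> x = (\<lambda>i. x (i - j))"
  by (simp add: conv_def fun_eq_iff)

lemma conv_one [simp]: "1 \<star> x = x"
  using conv_zpow[of 0 x] by simp

lemma conv_add_left: "(f + g) \<star> x = (\<lambda>i. (f \<star> x) i + (g \<star> x) i)"
proof
  fix i
  let ?S = "Poly_Mapping.keys f \<union> Poly_Mapping.keys g"
  have "Poly_Mapping.keys (f + g) \<subseteq> ?S"
    by (rule Poly_Mapping.keys_add)
  then show "((f + g) \<star> x) i = (f \<star> x) i + (g \<star> x) i"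
    by (simp add: conv_superset[of ?S] lookup_add distrib_right sum.distrib)
qed

lemma conv_diff_left: "(f - g) \<star> x = (\<lambda>i. (f \<star> x) i - (g \<star> x) i)"
  using conv_add_left[of "f - g" g x] by (simp add: fun_eq_iff)

lemma conv_zero_right [simp]: "f \<star> (\<lambda>_. 0) = (\<lambda>_. 0)"
  by (simp add: conv_def fun_eq_iff)

lemma conv_diff_right: "f \<star> (\<lambda>i. x i - y i) = (\<lambda>i. (f \<star> x) i - (f \<star> y) i)"
  by (simp add: conv_def fun_eq_iff sum_subtractf algebra_simps)

lemma conv_mult: "(f * g) \<star> x = f \<star> (g \<star> x)"
proof (induction f rule: laurent_induct)
  case (zpow i)
  show ?case
    by (induction g rule: laurent_induct) (simp_all add: conv_diff_left right_diff_distrib algebra_simps)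
qed (simp_all add: conv_diff_left left_diff_distrib)

lemma conv_commute: "f \<star> (g \<star> x) = g \<star> (f \<star> x)"
  by (metis conv_mult mult.commute)

lemma conv_lookup: "f \<star> Poly_Mapping.lookup g = Poly_Mapping.lookup (f * g)"
proof (induction f rule: laurent_induct)
  case (zpow i)
  show ?case
    by (induction g rule: laurent_induct)
      (auto simp: right_diff_distrib fun_eq_iff lookup_single lookup_minus when_def)
qed (simp_all add: conv_diff_left left_diff_distrib fun_eq_iff lookup_minus)

lemma conv_single: "Poly_Mapping.single j c \<star> x = (\<lambda>i. c * x (i - j))"
  by (cases "c = 0") (auto simp: conv_def)

lemma conv_sum_left: "(\<Sum>j\<in>A. f j) \<star> x = (\<lambda>i. \<Sum>j\<in>A. (f j \<star> x) i)"
  by (induction A rule: infinite_finite_induct) (simp_all add: conv_add_left)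

definition bounded_below :: "(int \<Rightarrow> int) \<Rightarrow> bool" where
  "bounded_below x \<longleftrightarrow> (\<exists>a. \<forall>i<a. x i = 0)"

lemma bounded_below_diff:
  "bounded_below x \<Longrightarrow> bounded_below y \<Longrightarrow> bounded_below (\<lambda>i. x i - y i)"
  unfolding bounded_below_def by (metis diff_zero linorder_less_linear order_less_trans)

lemma bounded_below_conv: "bounded_below x \<Longrightarrow> bounded_below (f \<star> x)"
proof (induction f rule: laurent_induct)
  case (zpow i)
  then obtain a where "\<forall>j<a. x j = 0"
    by (auto simp: bounded_below_def)
  then show ?case
    by (auto simp: bounded_below_def intro!: exI[of _ "a + i"])
qed (simp_all add: conv_diff_left bounded_below_diff, simp add: bounded_below_def)

definition reflect :: "(int \<Rightarrow> int) \<Rightarrow> int \<Rightarrow> int" where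
  "reflect x i = x (- i)"

text \<open>
  The Laurent series bounded on both sides are the Laurent polynomials.  This is where the
  divisibility statement for \<open>impulse\<close> below gets its quotient from.
\<close>

lemma finite_support_if_bounded_below:
  assumes "bounded_below x" "bounded_below (reflect x)"
  obtains f :: laurent_poly where "x = Poly_Mapping.lookup f"
proof -
  obtain a b where a: "\<forall>i<a. x i = 0" and b: "\<forall>i<b. x (- i) = 0"
    using assms by (auto simp: bounded_below_def reflect_def)
  have "{i. x i \<noteq> 0} \<subseteq> {a..-b}"
  proof
    fix i assume "i \<in> {i. x i \<noteq> 0}"
    then have "x i \<noteq> 0" "x (- (- i)) \<noteq> 0" by auto
    then have "\<not> i < a" "\<not> - i < b"
      using a b by blast+
    then show "i \<in> {a..-b}" by auto
  qed
  then have "finite {i. x i \<noteq> 0}"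
    by (rule finite_subset) auto
  then show ?thesis
    using that[of "Abs_poly_mapping x"] by simp
qed

lemma reflect_reflect [simp]: "reflect (reflect x) = x"
  by (simp add: reflect_def[abs_def])

lemma bounded_below_reflect_conv:
  assumes "bounded_below (reflect x)" shows "bounded_below (reflect (f \<star> x))"
proof (induction f rule: laurent_induct)
  case (zpow i)
  from assms obtain a where "\<forall>j<a. reflect x j = 0"
    by (auto simp: bounded_below_def)
  then have "reflect (zpow i \<star> x) j = 0" if "j < a - i" for j
    using \<open>\<forall>j<a. reflect x j = 0\<close>[rule_format, of "j + i"] that
      by (simp add: reflect_def minus_diff_commute)
  then show ?case
    by (auto simp: bounded_below_def)
qed (simp_all add: conv_diff_left bounded_below_diff reflect_def[abs_def], simp add: bounded_below_def)

section \<open>Integral solutions of a palindromic recurrence\<close>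

text \<open>
  The lowest coefficient of \<open>P\<close> is also \<open>1\<close>, by symmetry.  Hence the recurrence \<open>P \<star> x = 0\<close> can be
  solved over the integers in either direction, and reversal of time maps solutions to solutions.
\<close>

locale palindromic_monic =
  fixes P :: laurent_poly and m :: nat
  assumes lookup_neg: "Poly_Mapping.lookup P (- q) = Poly_Mapping.lookup P q"
    and lookup_top: "Poly_Mapping.lookup P (int m) = 1"
    and keys_P: "Poly_Mapping.keys P \<subseteq> {- int m..int m}"
begin

lemma conv_P: "(P \<star> x) i = (\<Sum>q\<in>{- int m..int m}. Poly_Mapping.lookup P q * x (i - q))"
  by (rule conv_superset) (use keys_P in auto)

text \<open>
  The equation at index \<open>i\<close> determines \<open>x (i + m)\<close> from the \<open>2 * m\<close> preceding values.
\<close>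

lemma conv_P_window:
  "(P \<star> x) i = (\<Sum>t<2 * m. Poly_Mapping.lookup P (int t - int m) * x (i - int m + int t)) + x (i + int m)"
proof -
  have "(P \<star> x) i = (\<Sum>t<Suc (2 * m). Poly_Mapping.lookup P (int t - int m) * x (i - int m + int t))"
    unfolding conv_P
  proof (rule sum.reindex_bij_witness[of _ "\<lambda>t. int m - int t" "\<lambda>q. nat (int m - q)"], goal_cases)
    case (5 q)
    then show ?case
      using lookup_neg[of q] by (simp add: algebra_simps)
  qed auto
  then show ?thesis
    using lookup_top by (simp add: algebra_simps)
qed

lemma conv_P_reflect: "P \<star> (\<lambda>i. x (c - i)) = (\<lambda>i. (P \<star> x) (c - i))"
proof
  fix i
  show "(P \<star> (\<lambda>i. x (c - i))) i = (P \<star> x) (c - i)"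
    unfolding conv_P
    by (rule sum.reindex_bij_witness[of _ uminus uminus]) (auto simp: lookup_neg algebra_simps)
qed

text \<open>
  A solution that starts from zero and is not driven before time \<open>a\<close> cannot leave zero before
  time \<open>a + m\<close>, because the equation at index \<open>i\<close> is first to involve the value at \<open>i + m\<close>.
\<close>

lemma causality:
  assumes x: "bounded_below x" and z: "\<And>i. i < a \<Longrightarrow> (P \<star> x) i = 0"
  shows "i < a + int m \<Longrightarrow> x i = 0"
proof -
  obtain b where b: "\<forall>i<b. x i = 0"
    using x by (auto simp: bounded_below_def)
  have "\<forall>i<a + int m. i < b + int r \<longrightarrow> x i = 0" for r
  proof (induction r)
    case 0
    then show ?case using b by simp
  next
    case (Suc r)
    show ?case
    proof (intro allI impI)
      fix i assume i: "i < a + int m" "i < b + int (Suc r)"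
      have "(P \<star> x) (i - int m) = 0"
        using z i by simp
      then have "x i = - (\<Sum>t<2 * m. Poly_Mapping.lookup P (int t - int m) * x (i - int m - int m + int t))"
        unfolding conv_P_window by simp
      also have "\<dots> = 0"
        using Suc i by (intro neg_equal_0_iff_equal[THEN iffD2] sum.neutral ballI) auto
      finally show "x i = 0" .
    qed
  qed
  from this[of "nat (i + 1 - b)"] show "i < a + int m \<Longrightarrow> x i = 0"
    by simp
qed

lemma conv_P_injective:
  assumes "bounded_below x" "P \<star> x = (\<lambda>_. 0)"
  shows "x = (\<lambda>_. 0)"
proof
  fix i show "x i = 0"
    using causality[OF assms(1), of "i + 1" i] assms(2) by simp
qed

definition delta :: "int \<Rightarrow> int" where "delta i = (if i = 0 then 1 else 0)"

text \<open>
  The fundamental solution of \<open>P\<close> supported on the right: the expansion of \<open>1 / P\<close> as a Laurent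
  series in \<open>z\<close>.  Clearing the denominator \<open>z\<close> to the power \<open>m\<close> turns \<open>P\<close> into a power series with
  constant term \<open>1\<close>, which has an integral inverse.
\<close>

definition green :: "int \<Rightarrow> int" where
  "green i = (if i < int m then 0 else
     fps_nth (fps_right_inverse (Abs_fps (\<lambda>r. Poly_Mapping.lookup P (int r - int m))) 1) (nat (i - int m)))"

lemma green_bounded_below: "bounded_below green"
  by (auto simp: bounded_below_def green_def)

lemma conv_green: "P \<star> green = delta"
proof
  fix i
  define F where "F = Abs_fps (\<lambda>r. Poly_Mapping.lookup P (int r - int m))"
  define Q where "Q = fps_right_inverse F 1"
  have F: "fps_nth F 0 = 1"
    using lookup_neg[of "int m"] by (simp add: F_def lookup_top)
  then have FQ: "F * Q = 1"
    unfolding Q_def by (intro fps_right_inverse) simp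
  show "(P \<star> green) i = delta i"
  proof (cases "i < 0")
    case True
    then have "\<forall>q\<in>{- int m..int m}. green (i - q) = 0"
      by (auto simp: green_def)
    then show ?thesis
      using True by (simp add: conv_P delta_def)
  next
    case False
    have "(P \<star> green) i = (\<Sum>q\<in>{- int m..max (int m) (i - int m)}. Poly_Mapping.lookup P q * green (i - q))"
      by (rule conv_superset) (use keys_P in force)+
    also have "\<dots> = (\<Sum>q\<in>{- int m..i - int m}. Poly_Mapping.lookup P q * green (i - q))"
      by (rule sum.mono_neutral_right) (auto simp: green_def)
    also have "\<dots> = (\<Sum>r=0..nat i. fps_nth F r * fps_nth Q (nat i - r))"
    proof (rule sum.reindex_bij_witness[of _ "\<lambda>r. int r - int m" "\<lambda>q. nat (q + int m)"], goal_cases)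
      case (5 q)
      then have "nat (i - q - int m) = nat i - nat (q + int m)" "int m \<le> i - q"
        by auto
      then show ?case
        using 5 by (simp add: F_def Q_def green_def)
    qed (use False in auto)
    also have "\<dots> = fps_nth (F * Q) (nat i)"
      by (simp add: fps_mult_nth)
    also have "\<dots> = delta i"
      using False by (auto simp: FQ delta_def)
    finally show ?thesis .
  qed
qed

text \<open>
  The difference of the two expansions of \<open>1 / P\<close>, in \<open>z\<close> and in \<open>1 / z\<close>.  Both are inverse to \<open>P\<close>,
  so their difference solves the homogeneous recurrence; it turns out to generate all solutions.
\<close>

definition impulse :: "int \<Rightarrow> int" where
  "impulse i = green i - reflect green i"

lemma conv_reflect: "P \<star> reflect x = reflect (P \<star> x)"
  using conv_P_reflect[of x 0] by (simp add: reflect_def[abs_def])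

lemma conv_reflect_green: "P \<star> reflect green = delta"
  by (auto simp: conv_reflect conv_green reflect_def delta_def)

lemma conv_delta: "f \<star> delta = Poly_Mapping.lookup f"
proof -
  have "delta = Poly_Mapping.lookup 1"
    by (auto simp: delta_def fun_eq_iff lookup_one when_def)
  show ?thesis
    unfolding \<open>delta = _\<close> conv_lookup by simp
qed

lemma conv_impulse: "f \<star> impulse = (\<lambda>i. (f \<star> green) i - (f \<star> reflect green) i)"
  unfolding impulse_def[abs_def] by (rule conv_diff_right)

lemma P_conv_impulse: "P \<star> impulse = (\<lambda>_. 0)"
  by (simp add: conv_impulse conv_green conv_reflect_green)

text \<open>
  If \<open>f\<close> kills \<open>impulse\<close>, then the two expansions of \<open>f / P\<close>, one bounded below and one bounded
  above, coincide.  Their common value is then a Laurent polynomial, the quotient of \<open>f\<close> by \<open>P\<close>.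
\<close>

lemma annihilator_impulse: "f \<star> impulse = (\<lambda>_. 0) \<longleftrightarrow> P dvd f"
proof
  assume "P dvd f"
  then obtain g where "f = g * P"
    by (auto simp: dvd_def mult.commute)
  then show "f \<star> impulse = (\<lambda>_. 0)"
    by (simp add: conv_mult P_conv_impulse)
next
  assume "f \<star> impulse = (\<lambda>_. 0)"
  then have eq: "f \<star> green = f \<star> reflect green"
    by (simp add: conv_impulse fun_eq_iff)
  have 1: "bounded_below (f \<star> green)"
    by (rule bounded_below_conv[OF green_bounded_below])
  have 2: "bounded_below (reflect (f \<star> green))"
    unfolding eq by (rule bounded_below_reflect_conv) (simp add: green_bounded_below)
  obtain g where g: "f \<star> green = Poly_Mapping.lookup g"
    using 1 2 by (rule finite_support_if_bounded_below)
  have "Poly_Mapping.lookup (P * g) = f \<star> (P \<star> green)"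
    unfolding conv_lookup[symmetric] g[symmetric] by (rule conv_commute)
  also have "\<dots> = Poly_Mapping.lookup f"
    by (simp add: conv_green conv_delta)
  finally have "P * g = f"
    by (simp add: poly_mapping_eqI)
  then show "P dvd f" by auto
qed

text \<open>
  Cutting \<open>x\<close> off to the left of \<open>0\<close> creates no defect in the recurrence, as only zeros of the
  window are next to the cut.  What remains is bounded below and therefore zero.
\<close>

lemma vanish_right:
  assumes P: "P \<star> x = (\<lambda>_. 0)" and w: "\<And>i. 0 \<le> i \<Longrightarrow> i < 2 * int m \<Longrightarrow> x i = 0"
    and "0 \<le> i"
  shows "x i = 0"
proof -
  define y where "y = (\<lambda>i. if i < 0 then 0 else x i)"
  have "(P \<star> y) i = 0" for i
  proof (cases "i < int m")
    case True
    have "\<forall>q\<in>{- int m..int m}. y (i - q) = 0"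
      using True w by (auto simp: y_def)
    then show ?thesis
      by (simp add: conv_P)
  next
    case False
    then have "(P \<star> y) i = (P \<star> x) i"
      unfolding conv_P by (intro sum.cong) (auto simp: y_def)
    then show ?thesis by (simp add: P)
  qed
  moreover have "bounded_below y"
    by (auto simp: bounded_below_def y_def)
  ultimately have "y = (\<lambda>_. 0)"
    using conv_P_injective[of y] by (simp add: fun_eq_iff)
  then have "y i = 0" by simp
  then show ?thesis
    using \<open>0 \<le> i\<close> by (simp add: y_def)
qed

lemma vanish_on_window:
  assumes P: "P \<star> x = (\<lambda>_. 0)" and w: "\<And>i. 0 \<le> i \<Longrightarrow> i < 2 * int m \<Longrightarrow> x i = 0"
  shows "x = (\<lambda>_. 0)"
proof
  fix i
  show "x i = 0"
  proof (cases "0 \<le> i")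
    case True
    then show ?thesis using vanish_right[OF P w] by blast
  next
    case False
    define x' where "x' = (\<lambda>i. x (2 * int m - 1 - i))"
    have "x' (2 * int m - 1 - i) = 0"
    proof (rule vanish_right[of x'])
      show "P \<star> x' = (\<lambda>_. 0)"
        unfolding x'_def conv_P_reflect by (simp add: P)
    qed (use w False in \<open>auto simp: x'_def\<close>)
    then show ?thesis by (simp add: x'_def)
  qed
qed

text \<open>
  Extend \<open>v\<close> by zero to a sequence \<open>x\<close>.  Then \<open>P \<star> x\<close> has one part near the left end of the window
  and one part near its right end.  With \<open>f\<close> the left part, the expansion of \<open>f / P\<close> in \<open>z\<close> agrees
  with \<open>x\<close> up to the right end of the window by causality, while the expansion in \<open>1 / z\<close> vanishes
  from the left end on, by causality in reversed time.
\<close>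

lemma window_surj:
  assumes "v \<in> carrier_vec (2 * m)"
  obtains f where "vec (2 * m) (\<lambda>j. (f \<star> impulse) (int j)) = v"
proof -
  define x where "x = (\<lambda>i. if 0 \<le> i \<and> i < 2 * int m then v $ nat i else 0)"
  have bx: "bounded_below x" "bounded_below (reflect x)"
    by (auto simp: bounded_below_def x_def reflect_def intro!: exI[of _ "- 2 * int m"])
  define c where "c = (\<lambda>i. if i < int m then (P \<star> x) i else 0)"
  have "bounded_below c"
    using bounded_below_conv[OF bx(1), of P] by (auto simp: c_def bounded_below_def)
  moreover have "bounded_below (reflect c)"
    by (auto simp: c_def bounded_below_def reflect_def intro!: exI[of _ "- int m"])
  ultimately obtain f where f: "c = Poly_Mapping.lookup f"
    by (rule finite_support_if_bounded_below)
  have Pf: "P \<star> (f \<star> green) = c" "P \<star> (f \<star> reflect green) = c"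
    by (simp_all add: conv_commute[of P] conv_green conv_reflect_green conv_delta f)
  \<comment> \<open>before index \<open>m\<close> both sequences are driven by \<open>c\<close>, so they agree up to \<open>2 * m\<close>\<close>
  have right: "(f \<star> green) i - x i = 0" if "i < 2 * int m" for i
  proof (rule causality[where a = "int m" and x = "\<lambda>i. (f \<star> green) i - x i"])
    show "bounded_below (\<lambda>i. (f \<star> green) i - x i)"
      by (intro bounded_below_diff bounded_below_conv green_bounded_below bx)
  qed (use that in \<open>auto simp: conv_diff_right Pf c_def\<close>)
  \<comment> \<open>reversed, \<open>c\<close> drives only from \<open>1 - m\<close> on, so the response starts at \<open>1\<close> or later\<close>
  have left: "(f \<star> reflect green) i = 0" if "0 \<le> i" for i
  proof -
    have "reflect (f \<star> reflect green) (- i) = 0"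
    proof (rule causality[where a = "1 - int m" and x = "reflect (f \<star> reflect green)"])
      show "bounded_below (reflect (f \<star> reflect green))"
        by (rule bounded_below_reflect_conv) (simp add: green_bounded_below)
    qed (use that in \<open>auto simp: conv_reflect Pf reflect_def c_def\<close>)
    then show ?thesis by (simp add: reflect_def)
  qed
  have "vec (2 * m) (\<lambda>j. (f \<star> impulse) (int j)) = v"
  proof (rule eq_vecI)
    fix j assume "j < dim_vec v"
    then have j: "j < 2 * m" using assms by simp
    then have "(f \<star> impulse) (int j) = x (int j)"
      using right[of "int j"] left[of "int j"] by (simp add: conv_impulse)
    then show "vec (2 * m) (\<lambda>j. (f \<star> impulse) (int j)) $ j = v $ j"
      using j by (simp add: x_def)
  qed (use assms in simp)
  then show ?thesis by (rule that)
qed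

section \<open>Companion matrix and cokernel\<close>

lemma low_exp_P: "low_exp P = - int m"
  unfolding low_exp_def
  by (rule Min_eqI) (use keys_P lookup_top lookup_neg[of "int m"] in \<open>auto simp: in_keys_iff\<close>)

lemma high_exp_P: "high_exp P = int m"
  unfolding high_exp_def
  by (rule Max_eqI) (use keys_P lookup_top in \<open>auto simp: in_keys_iff\<close>)

lemma companion_mat_P:
  "companion_mat P = mat (2 * m) (2 * m) (\<lambda>(i, j). if i < 2 * m - 1 then (if j = i + 1 then 1 else 0)
     else - Poly_Mapping.lookup P (int j - int m))"
proof -
  have "nat (int m - - int m) = 2 * m" by simp
  then show ?thesis
    unfolding companion_mat_def Let_def low_exp_P high_exp_P uminus_add_conv_diff by simp
qed

lemma companion_mat_carrier: "companion_mat P \<in> carrier_mat (2 * m) (2 * m)"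
  by (simp add: companion_mat_P)

definition window :: "(int \<Rightarrow> int) \<Rightarrow> int vec" where
  "window x = vec (2 * m) (\<lambda>j. x (int j))"

lemma window_carrier [simp]: "window x \<in> carrier_vec (2 * m)"
  by (simp add: window_def)

text \<open>
  On windows of solutions the companion matrix is the shift to the left: its last row evaluates
  the recurrence for the value that enters the window.
\<close>

lemma companion_mult_window:
  assumes "P \<star> x = (\<lambda>_. 0)"
  shows "companion_mat P *\<^sub>v window x = window (zpow (- 1) \<star> x)"
proof (rule eq_vecI)
  fix i assume "i < dim_vec (window (zpow (- 1) \<star> x))"
  then have i: "i < 2 * m" by (simp add: window_def)
  have row: "(companion_mat P *\<^sub>v window x) $ i = (\<Sum>j<2 * m. companion_mat P $$ (i, j) * x (int j))"
    using i by (simp add: companion_mat_P scalar_prod_def window_def lessThan_atLeast0)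
  show "(companion_mat P *\<^sub>v window x) $ i = window (zpow (- 1) \<star> x) $ i"
  proof (cases "i < 2 * m - 1")
    case True
    then have "(companion_mat P *\<^sub>v window x) $ i = (\<Sum>j<2 * m. if j = i + 1 then x (int j) else 0)"
      unfolding row using i by (intro sum.cong) (auto simp: companion_mat_P)
    also have "\<dots> = x (int i + 1)"
      using True by (simp add: sum.delta add.commute)
    finally show ?thesis
      using i by (simp add: window_def)
  next
    case False
    then have last: "int i + 1 = int m + int m"
      using i by linarith
    have "(companion_mat P *\<^sub>v window x) $ i = - (\<Sum>j<2 * m. Poly_Mapping.lookup P (int j - int m) * x (int j))"
      unfolding row sum_negf[symmetric] using False i by (intro sum.cong) (auto simp: companion_mat_P)
    also have "\<dots> = x (int m + int m)"
      using conv_P_window[of x "int m"] assms by simp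
    finally show ?thesis
      using i by (simp add: window_def last)
  qed
qed (simp add: companion_mat_P window_def)

lemma conv_P_conv:
  "P \<star> x = (\<lambda>_. 0) \<Longrightarrow> P \<star> (f \<star> x) = (\<lambda>_. 0)"
  by (simp add: conv_commute[of P f])

lemma companion_pow_mult_window:
  assumes "P \<star> x = (\<lambda>_. 0)"
  shows "companion_mat P ^\<^sub>m n *\<^sub>v window x = window (zpow (- int n) \<star> x)"
  using assms
proof (induction n arbitrary: x)
  case 0
  then show ?case
    by (simp add: companion_mat_P window_def)
next
  case (Suc n)
  have "companion_mat P ^\<^sub>m Suc n *\<^sub>v window x = companion_mat P ^\<^sub>m n *\<^sub>v (companion_mat P *\<^sub>v window x)"
    using companion_mat_carrier by (simp add: assoc_mult_mat_vec[where ?n\<^sub>1 = "2 * m" and ?n\<^sub>2 = "2 * m" and ?n\<^sub>3 = "2 * m"])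
  also have "\<dots> = window (zpow (- int n) \<star> (zpow (- 1) \<star> x))"
    unfolding companion_mult_window[OF Suc.prems]
    by (rule Suc.IH[OF conv_P_conv[OF Suc.prems]])
  finally show ?case
    by (simp add: algebra_simps)
qed

definition rel_ideal :: "nat \<Rightarrow> laurent_poly set" where
  "rel_ideal n = {a * (zpow (int n) - 1) + b * P | a b. True}"

lemma ideal_mult: "f \<in> rel_ideal n \<Longrightarrow> g * f \<in> rel_ideal n"
proof -
  assume "f \<in> rel_ideal n"
  then obtain a b where f: "f = a * (zpow (int n) - 1) + b * P"
    by (auto simp: rel_ideal_def)
  have "g * f = (g * a) * (zpow (int n) - 1) + (g * b) * P"
    unfolding f by (simp add: algebra_simps)
  then show ?thesis
    unfolding rel_ideal_def by blast
qed

lemma ideal_diff: "f \<in> rel_ideal n \<Longrightarrow> g \<in> rel_ideal n \<Longrightarrow> f - g \<in> rel_ideal n"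
proof -
  assume "f \<in> rel_ideal n" "g \<in> rel_ideal n"
  then obtain a b a' b' where fg: "f = a * (zpow (int n) - 1) + b * P" "g = a' * (zpow (int n) - 1) + b' * P"
    by (auto simp: rel_ideal_def)
  have "f - g = (a - a') * (zpow (int n) - 1) + (b - b') * P"
    unfolding fg by (simp add: algebra_simps)
  then show ?thesis
    unfolding rel_ideal_def by blast
qed

lemma ideal_dvd: "zpow (int n) - 1 dvd f \<Longrightarrow> f \<in> rel_ideal n"
proof -
  assume "zpow (int n) - 1 dvd f"
  then obtain a where "f = a * (zpow (int n) - 1) + 0 * P"
    by (auto simp: dvd_def mult.commute)
  then show ?thesis
    unfolding rel_ideal_def by blast
qed

lemma ideal_P: "P * b \<in> rel_ideal n"
proof -
  have "P * b = 0 * (zpow (int n) - 1) + b * P"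
    by (simp add: mult.commute)
  then show ?thesis
    unfolding rel_ideal_def by blast
qed

lemma ideal_zero: "0 \<in> rel_ideal n"
  using ideal_dvd[of n 0] by simp

lemma ideal_add: "f \<in> rel_ideal n \<Longrightarrow> g \<in> rel_ideal n \<Longrightarrow> f + g \<in> rel_ideal n"
  using ideal_diff[of f n "0 - g"] ideal_diff[OF ideal_zero, of g n] by simp

lemma window_add: "window (\<lambda>i. x i + y i) = window x + window y"
  by (auto simp: window_def)

lemma window_diff: "window (\<lambda>i. x i - y i) = window x - window y"
  by (auto simp: window_def)

lemma window_eq_0D:
  assumes "P \<star> x = (\<lambda>_. 0)" and "window x = 0\<^sub>v (2 * m)"
  shows "x = (\<lambda>_. 0)"
proof (rule vanish_on_window[OF assms(1)])
  fix i :: int assume "0 \<le> i" "i < 2 * int m"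
  then have "window x $ nat i = x i" and "nat i < 2 * m"
    by (simp_all add: window_def nat_less_iff)
  then show "x i = 0"
    using assms(2) by simp
qed

text \<open>
  Windows of the sequences \<open>g \<star> impulse\<close> exhaust all integer vectors, and on them the matrix acts as
  multiplication of \<open>g\<close> by \<open>zpow (- n) - 1\<close>, a unit multiple of \<open>zpow n - 1\<close>.  The window of
  \<open>f \<star> impulse\<close> vanishes only for \<open>f\<close> divisible by \<open>P\<close>.  So the cokernel of the matrix is the
  quotient of the Laurent polynomials by the ideal.
\<close>

lemma impulse_window_in_image_iff:
  "window (f \<star> impulse) \<in> (\<lambda>v. (companion_mat P ^\<^sub>m n - 1\<^sub>m (2 * m)) *\<^sub>v v) ` carrier_vec (2 * m)
     \<longleftrightarrow> f \<in> rel_ideal n"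
proof -
  let ?M = "companion_mat P ^\<^sub>m n - 1\<^sub>m (2 * m)"
  let ?T = "zpow (- int n) - 1"
  have P0: "P \<star> (g \<star> impulse) = (\<lambda>_. 0)" for g
    by (rule conv_P_conv[OF P_conv_impulse])
  have M: "?M *\<^sub>v window (g \<star> impulse) = window ((?T * g) \<star> impulse)" for g
  proof -
    have "?M *\<^sub>v window (g \<star> impulse) = companion_mat P ^\<^sub>m n *\<^sub>v window (g \<star> impulse) - window (g \<star> impulse)"
      using companion_mat_carrier
      by (subst minus_mult_distrib_mat_vec[where nr = "2 * m" and nc = "2 * m"]) auto
    then show ?thesis
      by (simp only: companion_pow_mult_window[OF P0] conv_mult conv_diff_left window_diff conv_one)
  qed
  have rel: "f - ?T * g \<in> rel_ideal n \<longleftrightarrow> f \<in> rel_ideal n" for g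
  proof -
    have "?T * g = (zpow (int n) - 1) * (- zpow (- int n) * g)"
      by (simp add: algebra_simps mult.assoc[symmetric])
    then have T: "?T * g \<in> rel_ideal n"
      by (intro ideal_dvd) (simp only: dvd_triv_left)
    show ?thesis
      using ideal_diff[OF _ T, of f] ideal_add[OF _ T, of "f - ?T * g"] by auto
  qed
  show ?thesis
  proof
    assume "window (f \<star> impulse) \<in> (\<lambda>v. ?M *\<^sub>v v) ` carrier_vec (2 * m)"
    then obtain v where v: "v \<in> carrier_vec (2 * m)" "window (f \<star> impulse) = ?M *\<^sub>v v"
      by auto
    obtain g where g: "window (g \<star> impulse) = v"
      using window_surj[OF v(1)] by (auto simp: window_def)
    have "window ((f - ?T * g) \<star> impulse) = 0\<^sub>v (2 * m)"
      unfolding conv_diff_left[of f] window_diff v(2) g[symmetric] M by (simp add: window_def)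
    then have "P dvd f - ?T * g"
      using window_eq_0D[OF P0] annihilator_impulse by blast
    then show "f \<in> rel_ideal n"
      unfolding rel[symmetric, of g] by (auto simp: ideal_P)
  next
    assume "f \<in> rel_ideal n"
    then obtain a b where ab: "f = a * (zpow (int n) - 1) + b * P"
      by (auto simp: rel_ideal_def)
    have "a * (zpow (int n) - 1) = ?T * (- zpow (int n) * a)"
      by (simp add: algebra_simps mult.assoc[symmetric])
    then have "f \<star> impulse = (?T * (- zpow (int n) * a)) \<star> impulse"
      unfolding ab conv_add_left conv_mult[of b] P_conv_impulse by simp
    then have "window (f \<star> impulse) = ?M *\<^sub>v window ((- zpow (int n) * a) \<star> impulse)"
      unfolding M by simp
    then show "window (f \<star> impulse) \<in> (\<lambda>v. ?M *\<^sub>v v) ` carrier_vec (2 * m)"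
      by simp
  qed
qed

end

section \<open>Augmentation and torsion\<close>

text \<open>
  The value of a Laurent polynomial at \<open>z = 1\<close>.
\<close>

definition aug :: "laurent_poly \<Rightarrow> int" where
  "aug f = (f \<star> (\<lambda>_. 1)) 0"

lemma conv_const: "f \<star> (\<lambda>_. c) = (\<lambda>_. c * aug f)"
  by (simp add: conv_def aug_def fun_eq_iff sum_distrib_left mult.commute)

lemma aug_mult: "aug (f * g) = aug f * aug g"
proof -
  have "aug (f * g) = (f \<star> (g \<star> (\<lambda>_. 1))) 0"
    by (simp only: aug_def conv_mult)
  then show ?thesis
    by (simp only: conv_const mult_1_left mult.commute)
qed

lemma aug_diff: "aug (f - g) = aug f - aug g"
  by (simp add: aug_def conv_diff_left)

lemma aug_add: "aug (f + g) = aug f + aug g"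
  by (simp add: aug_def conv_add_left)

lemma aug_zero [simp]: "aug 0 = 0"
  and aug_zpow [simp]: "aug (zpow i) = 1"
  and aug_one [simp]: "aug 1 = 1"
  by (simp_all add: aug_def)

lemma aug_of_nat [simp]: "aug (of_nat n) = int n"
  by (induction n) (simp_all add: aug_add)

lemma conv_of_nat: "of_nat d \<star> x = (\<lambda>i. int d * x i)"
  by (induction d) (simp_all add: conv_add_left fun_eq_iff algebra_simps)

lemma conv_of_int: "of_int d \<star> x = (\<lambda>i. d * x i)"
  using conv_diff_left[of 0 _ x] by (cases d rule: int_cases2) (simp_all add: conv_of_nat)

lemma zpow_dvd_zpow_diff: "zpow a - 1 dvd zpow (q + a * t) - zpow q"
proof (induction t rule: int_induct[where k = 0])
  case (step1 t)
  have eq: "zpow (q + a * (t + 1)) - zpow q = zpow (q + a * t) * (zpow a - 1) + (zpow (q + a * t) - zpow q)"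
    by (simp add: algebra_simps)
  show ?case
    unfolding eq using step1.IH by (intro dvd_add) simp_all
next
  case (step2 t)
  have eq: "zpow (q + a * (t - 1)) - zpow q = (zpow (q + a * t) - zpow q) - zpow (q + a * (t - 1)) * (zpow a - 1)"
    by (simp add: algebra_simps)
  show ?case
    unfolding eq by (rule dvd_diff) (use step2.IH in simp_all)
qed simp

context
  fixes n :: nat
  assumes n: "n > 0"
begin

text \<open>
  The module of \<open>n\<close>-periodic sequences is a model of the quotient by \<open>zpow n - 1\<close>: the map
  \<open>f \<mapsto> f \<star> comb\<close> folds \<open>f\<close> to a sequence of period \<open>n\<close>, and \<open>spread\<close> is a section of it.
\<close>

definition comb :: "int \<Rightarrow> int" where
  "comb i = (if int n dvd i then 1 else 0)"

lemma conv_comb_periodic: "(f \<star> comb) (i + int n * t) = (f \<star> comb) i"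
proof -
  have "int n dvd i + int n * t - j \<longleftrightarrow> int n dvd i - j" for j
    by (metis add_diff_eq diff_add_eq dvd_add_left_iff dvd_triv_left)
  then show ?thesis
    by (simp add: conv_def comb_def)
qed

lemma comb_single: "i < n \<Longrightarrow> j < n \<Longrightarrow> comb (int i - int j) = (if i = j then 1 else 0)"
  by (auto simp: comb_def) (metis diff_add_cancel diff_zero mod_0_imp_dvd mod_eq_dvd_iff mod_less of_nat_eq_iff zmod_int)

definition spread :: "(nat \<Rightarrow> int) \<Rightarrow> laurent_poly" where
  "spread y = (\<Sum>j<n. Poly_Mapping.single (int j) (y j))"

lemma conv_spread: "(spread y \<star> x) i = (\<Sum>j<n. y j * x (i - int j))"
  by (simp add: spread_def conv_sum_left conv_single)

lemma conv_spread_comb: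
  assumes "i < n" shows "(spread y \<star> comb) (int i) = y i"
proof -
  have "(spread y \<star> comb) (int i) = (\<Sum>j<n. if j = i then y j else 0)"
    unfolding conv_spread by (intro sum.cong) (auto simp: comb_single assms)
  then show ?thesis
    using assms by simp
qed

text \<open>
  Reducing exponents modulo \<open>n\<close> replaces \<open>f\<close> by a combination of the powers \<open>0, \<dots>, n - 1\<close>, whose
  coefficients can be read off after folding.
\<close>

lemma conv_comb_zeroD:
  assumes "\<And>i. i < n \<Longrightarrow> (f \<star> comb) (int i) = 0"
  shows "zpow (int n) - 1 dvd f"
proof -
  have "\<exists>y. zpow (int n) - 1 dvd f - spread y" for f
  proof (induction f rule: laurent_induct)
    case zero
    have "spread (\<lambda>_. 0) = 0" by (simp add: spread_def)
    then show ?case by (metis diff_self dvd_0_right)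
  next
    case (zpow q)
    have "spread (\<lambda>j. if j = nat (q mod int n) then 1 else 0) = (\<Sum>j<n. if j = nat (q mod int n) then zpow (q mod int n) else 0)"
      unfolding spread_def by (intro sum.cong) (use n in auto)
    also have "\<dots> = zpow (q mod int n)"
      using n by (simp add: nat_less_iff)
    finally have "spread (\<lambda>j. if j = nat (q mod int n) then 1 else 0) = zpow (q mod int n)" .
    moreover have "zpow (int n) - 1 dvd zpow q - zpow (q mod int n)"
      using zpow_dvd_zpow_diff[of "int n" "q mod int n" "q div int n"] by simp
    ultimately show ?case by metis
  next
    case (diff a b)
    then obtain y z where "zpow (int n) - 1 dvd a - spread y" "zpow (int n) - 1 dvd b - spread z"
      by auto
    then have "zpow (int n) - 1 dvd (a - spread y) - (b - spread z)"
      by (rule dvd_diff)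
    also have "(a - spread y) - (b - spread z) = a - b - spread (\<lambda>j. y j - z j)"
      by (simp add: spread_def single_diff sum_subtractf algebra_simps)
    finally show ?case by blast
  qed
  then obtain y where y: "zpow (int n) - 1 dvd f - spread y"
    by blast
  then obtain g where g: "f - spread y = g * (zpow (int n) - 1)"
    by (auto simp: dvd_def mult.commute)
  have z: "(zpow (int n) - 1) \<star> comb = (\<lambda>_. 0)"
    using conv_comb_periodic[of 1 _ "-1"] by (simp add: conv_diff_left fun_eq_iff)
  have "(\<lambda>i. (f \<star> comb) i - (spread y \<star> comb) i) = (\<lambda>_. 0)"
    using arg_cong[OF g, of "\<lambda>h. h \<star> comb"]
    by (simp only: conv_mult z conv_diff_left[of f] conv_zero_right)
  then have "f \<star> comb = spread y \<star> comb"
    by (simp add: fun_eq_iff)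
  then have "y i = 0" if "i < n" for i
    using assms[OF that] conv_spread_comb[OF that] by simp
  then have "spread y = 0"
    by (simp add: spread_def)
  with y show ?thesis by simp
qed

lemma sum_conv_comb: "(\<Sum>i<n. (f \<star> comb) (int i)) = aug f"
proof (induction f rule: laurent_induct)
  case (zpow q)
  have "(\<Sum>i<n. (zpow q \<star> comb) (int i)) = (\<Sum>i<n. if i = nat (q mod int n) then 1 else 0)"
  proof (rule sum.cong)
    fix i assume "i \<in> {..<n}"
    then have "int i mod int n = int i" by simp
    then have "int n dvd int i - q \<longleftrightarrow> int i = q mod int n"
      by (metis mod_eq_dvd_iff)
    then show "(zpow q \<star> comb) (int i) = (if i = nat (q mod int n) then 1 else 0)"
      using n by (auto simp: comb_def)
  qed simp
  then show ?case
    using n by (simp add: nat_less_iff)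
qed (simp_all add: conv_diff_left sum_subtractf aug_diff)

end

context palindromic_monic
begin

text \<open>
  Augmentation is a ring homomorphism to the integers that kills the ideal, so torsion elements
  have augmentation zero.  For the converse, multiplication by \<open>P\<close> on the quotient by \<open>zpow n - 1\<close>
  is a singular integer matrix, since its columns sum to zero.  When only constants are
  annihilated by \<open>P\<close>, adding the all-ones matrix makes it nonsingular, and Cramer's rule for the
  resulting matrix \<open>B\<close> solves \<open>P * h = det B * f\<close> modulo \<open>zpow n - 1\<close>: the all-ones summand
  contributes nothing, because \<open>f\<close> and hence \<open>h\<close> have augmentation zero.
\<close>

lemma torsion_iff:
  fixes n :: nat
  assumes n: "n > 0" and P0: "aug P = 0"
    and harmonic: "\<And>x. (\<And>i. x (i + int n) = x i) \<Longrightarrow> P \<star> x = (\<lambda>_. 0) \<Longrightarrow> \<exists>c. x = (\<lambda>_. c)"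
  shows "aug f = 0 \<longleftrightarrow> (\<exists>d>0. of_nat d * f \<in> rel_ideal n)"
proof
  assume "\<exists>d>0. of_nat d * f \<in> rel_ideal n"
  then obtain d :: nat and a b where d: "d > 0" "of_nat d * f = a * (zpow (int n) - 1) + b * P"
    by (auto simp: rel_ideal_def)
  have "int d * aug f = aug (a * (zpow (int n) - 1) + b * P)"
    unfolding d(2)[symmetric] by (simp add: aug_mult)
  also have "\<dots> = 0"
    by (simp add: aug_mult aug_add aug_diff P0)
  finally show "aug f = 0"
    using d by simp
next
  assume f: "aug f = 0"
  let ?comb = "comb n"
  define B where "B = mat n n (\<lambda>(i, j). (P \<star> ?comb) (int i - int j) + 1)"
  have B: "B \<in> carrier_mat n n"
    by (simp add: B_def)
  have Bmult: "(B *\<^sub>v y) $ i = ((P * spread n (($) y)) \<star> ?comb) (int i) + aug (spread n (($) y))"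
    if "y \<in> carrier_vec n" "i < n" for y i
  proof -
    have "(B *\<^sub>v y) $ i = (\<Sum>j<n. y $ j * (P \<star> ?comb) (int i - int j)) + (\<Sum>j<n. y $ j)"
      using that by (simp add: B_def scalar_prod_def lessThan_atLeast0 algebra_simps sum.distrib)
    also have "(\<Sum>j<n. y $ j * (P \<star> ?comb) (int i - int j)) = ((P * spread n (($) y)) \<star> ?comb) (int i)"
      by (simp add: mult.commute[of P] conv_mult conv_spread[OF n])
    also have "(\<Sum>j<n. y $ j) = aug (spread n (($) y))"
      by (simp add: aug_def conv_spread[OF n])
    finally show ?thesis .
  qed
  have Bsum: "(\<Sum>i<n. (B *\<^sub>v y) $ i) = int n * aug (spread n (($) y))" if "y \<in> carrier_vec n" for y
    using that by (simp add: Bmult sum.distrib sum_conv_comb[OF n] aug_mult P0)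
  have "det B \<noteq> 0"
  proof
    assume "det B = 0"
    then obtain y where y: "y \<in> carrier_vec n" "y \<noteq> 0\<^sub>v n" "B *\<^sub>v y = 0\<^sub>v n"
      using det_0_iff_vec_prod_zero[OF B] by auto
    define h where "h = spread n (($) y)"
    have h0: "aug h = 0"
      using Bsum[OF y(1)] n by (simp add: y(3) h_def)
    have "((P * h) \<star> ?comb) (int i) = 0" if "i < n" for i
      using Bmult[OF y(1) that] that h0 by (simp add: y(3) h_def)
    moreover have per: "(g \<star> ?comb) i = (g \<star> ?comb) (int (nat (i mod int n)))" for g i
      using conv_comb_periodic[OF n, of g "i mod int n" "i div int n"] n by simp
    moreover have "nat (i mod int n) < n" for i
      using n by (simp add: nat_less_iff)
    ultimately have "((P * h) \<star> ?comb) i = 0" for i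
      by metis
    then have "P \<star> (h \<star> ?comb) = (\<lambda>_. 0)"
      by (simp add: conv_mult fun_eq_iff)
    moreover have "(h \<star> ?comb) (i + int n) = (h \<star> ?comb) i" for i
      using conv_comb_periodic[OF n, of h i 1] by simp
    ultimately obtain c where c: "h \<star> ?comb = (\<lambda>_. c)"
      using harmonic by blast
    have "c = 0"
      using sum_conv_comb[OF n, of h] c h0 n by simp
    then have "y $ i = 0" if "i < n" for i
      using conv_spread_comb[OF n that, of "($) y"] c by (simp add: h_def)
    then show False
      using y by auto
  qed
  define w where "w = adj_mat B *\<^sub>v vec n (\<lambda>i. (f \<star> ?comb) (int i))"
  define h where "h = spread n (($) w)"
  have w: "w \<in> carrier_vec n"
    using adj_mat(1)[OF B] by (auto simp: w_def)
  have "B *\<^sub>v w = (B * adj_mat B) *\<^sub>v vec n (\<lambda>i. (f \<star> ?comb) (int i))"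
    unfolding w_def using B adj_mat(1)[OF B] by (subst assoc_mult_mat_vec) auto
  then have Bw: "(B *\<^sub>v w) $ i = det B * (f \<star> ?comb) (int i)" if "i < n" for i
    using that by (simp add: adj_mat(2)[OF B])
  have "int n * aug h = det B * aug f"
    using Bsum[OF w] sum_conv_comb[OF n, of f] by (simp add: h_def Bw sum_distrib_left[symmetric])
  then have h0: "aug h = 0"
    using f n by simp
  have "zpow (int n) - 1 dvd P * h - of_int (det B) * f"
  proof (rule conv_comb_zeroD[OF n])
    fix i assume "i < n"
    then show "((P * h - of_int (det B) * f) \<star> ?comb) (int i) = 0"
      using Bmult[OF w] Bw h0 by (simp add: conv_diff_left conv_mult conv_of_int h_def)
  qed
  then have *: "of_int (det B) * f \<in> rel_ideal n"
    using ideal_diff[OF ideal_P ideal_dvd, of n _ h] by fastforce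
  have "(of_nat (nat \<bar>det B\<bar>) :: laurent_poly) = of_int (sgn (det B) * det B)"
    by (auto simp: abs_if sgn_if of_nat_nat)
  then have "of_nat (nat \<bar>det B\<bar>) * f = of_int (sgn (det B)) * (of_int (det B) * f)"
    by (simp add: mult.assoc)
  then have "of_nat (nat \<bar>det B\<bar>) * f \<in> rel_ideal n"
    by (simp only: ideal_mult[OF *])
  then show "\<exists>d>0. of_nat d * f \<in> rel_ideal n"
    using \<open>det B \<noteq> 0\<close> by (intro exI[of _ "nat \<bar>det B\<bar>"]) simp
qed

end

section \<open>The Laurent polynomial of an I-graph\<close>

lemma closed_under_multiples:
  fixes S :: "int set"
  assumes "\<And>i. i \<in> S \<Longrightarrow> i + k \<in> S" "\<And>i. i \<in> S \<Longrightarrow> i - k \<in> S" "i \<in> S"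
  shows "i + a * k \<in> S"
proof (induction a rule: int_induct[where k = 0])
  case (step1 a)
  then show ?case
    using assms(1)[of "i + a * k"] by (simp add: algebra_simps)
next
  case (step2 a)
  then show ?case
    using assms(2)[of "i + a * k"] by (simp add: algebra_simps)
qed (use assms in simp)

text \<open>
  On sequences this is the Laplacian of a chain of vertices \<open>k\<close> apart, plus the identity: each
  vertex of an I-graph has degree three, and two of its neighbours are \<open>k\<close> (or \<open>l\<close>) steps away.
\<close>

definition laplace :: "nat \<Rightarrow> laurent_poly" where
  "laplace k = 3 - zpow (int k) - zpow (- int k)"

lemma I_poly_laplace: "I_poly k l = laplace k * laplace l - 1"
  by (simp add: I_poly_def laplace_def)

lemma conv_laplace: "(laplace k \<star> x) i = 3 * x i - x (i - int k) - x (i + int k)"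
  using conv_of_nat[of 3 x] by (simp add: laplace_def conv_diff_left)

lemma laplace_mult_zpow: "laplace c * zpow q = zpow q + zpow q + zpow q - zpow (q - int c) - zpow (q + int c)"
proof -
  have "(3 :: laurent_poly) = 1 + 1 + 1" by simp
  then show ?thesis
    unfolding laplace_def by (simp add: algebra_simps del: one_add_one)
qed

lemma aug_laplace: "aug (laplace c) = 1"
  using aug_of_nat[of 3] by (simp add: laplace_def aug_diff)

lemma aug_I_poly: "aug (I_poly k l) = 0"
  using aug_of_nat[of 3] by (simp add: I_poly_laplace laplace_def aug_diff aug_mult)

text \<open>
  The maximum principle.  With \<open>y = laplace l \<star> x\<close>, the pair \<open>x, y\<close> is a harmonic function on a
  connected 3-valent graph, periodic and therefore with a maximum.  Where it is attained, it is
  attained at the three neighbours too, and so the set of maximal places is closed under steps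
  by \<open>k\<close> and \<open>l\<close>, which generate all integers.
\<close>

lemma I_poly_harmonic:
  assumes n: "n > 0" and kl: "gcd k l = 1"
    and per: "\<And>i. x (i + int n) = x i" and P: "I_poly k l \<star> x = (\<lambda>_. 0)"
  shows "\<exists>c. x = (\<lambda>_. c)"
proof -
  define y where "y = laplace l \<star> x"
  have y: "y i = 3 * x i - x (i - int l) - x (i + int l)" for i
    by (simp add: y_def conv_laplace)
  have x: "x i = 3 * y i - y (i - int k) - y (i + int k)" for i
    using fun_cong[OF P, of i]
    by (simp add: I_poly_laplace conv_diff_left conv_mult y_def[symmetric] conv_laplace[of k])
  have per_y: "y (i + int n) = y i" for i
    using per[of i] per[of "i - int l"] per[of "i + int l"] by (simp add: y algebra_simps)
  have fin: "finite (range z)" if "\<And>i. z (i + int n) = z i" for z :: "int \<Rightarrow> int"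
  proof -
    have "z (i + int n * t) = z i" for i t
    proof (induction t rule: int_induct[where k = 0])
      case (step1 t)
      then show ?case using that[of "i + int n * t"] by (simp add: algebra_simps)
    next
      case (step2 t)
      then show ?case using that[of "i + int n * (t - 1)"] by (simp add: algebra_simps)
    qed simp
    then have "z i = z (i mod int n)" for i
      by (metis mod_mult_div_eq)
    then have "range z \<subseteq> z ` {0..<int n}"
      using n by (auto simp: image_def intro!: bexI[of _ "_ mod int n"])
    then show ?thesis
      by (rule finite_subset) auto
  qed
  define M where "M = Max (range x \<union> range y)"
  have fin': "finite (range x \<union> range y)"
    using fin[of x, OF per] fin[of y, OF per_y] by simp
  have le: "x i \<le> M" "y i \<le> M" for i
    using fin' by (auto simp: M_def)
  define S where "S = {i. x i = M}"
  have yS: "i \<in> S" "i + int k \<in> {i. y i = M}" "i - int k \<in> {i. y i = M}" if "y i = M" for i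
    using x[of i] le(1)[of i] le(2)[of "i - int k"] le(2)[of "i + int k"] that
    by (auto simp: S_def)
  have xS: "y i = M" "i + int l \<in> S" "i - int l \<in> S" if "i \<in> S" for i
    using y[of i] le(2)[of i] le(1)[of "i - int l"] le(1)[of "i + int l"] that
    by (auto simp: S_def)
  have kS: "i + int k \<in> S" "i - int k \<in> S" if "i \<in> S" for i
    using yS xS that by blast+
  have "M \<in> range x \<union> range y"
    unfolding M_def by (rule Max_in) (use fin' in auto)
  then obtain i where i: "i \<in> S"
    using yS by (auto simp: S_def)
  obtain a b where ab: "a * int k + b * int l = 1"
    using bezout_int[of "int k" "int l"] kl by auto
  have one: "j + 1 \<in> S" "j - 1 \<in> S" if "j \<in> S" for j
  proof -
    have "j + c * int k + d * int l \<in> S" for c d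
      by (intro closed_under_multiples kS xS that)
    from this[of a b] this[of "- a" "- b"] show "j + 1 \<in> S" "j - 1 \<in> S"
      using ab by (auto simp: algebra_simps)
  qed
  have "i + (j - i) * 1 \<in> S" for j
    by (intro closed_under_multiples one i)
  then have "x j = M" for j
    by (simp add: S_def)
  then show ?thesis by auto
qed

lemma palindromic_monic_I_poly:
  assumes "k > 0" "l > 0"
  shows "palindromic_monic (I_poly k l) (k + l)"
proof
  show "Poly_Mapping.lookup (I_poly k l) (- q) = Poly_Mapping.lookup (I_poly k l) q" for q
    unfolding lookup_I_poly by (simp add: when_def)
  show "Poly_Mapping.lookup (I_poly k l) (int (k + l)) = 1"
    using bimonic_I_poly[OF assms] by (simp add: bimonic_def high_exp_I_poly[OF assms])
  have "finite (Poly_Mapping.keys (I_poly k l))" by simp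
  then show "Poly_Mapping.keys (I_poly k l) \<subseteq> {- int (k + l)..int (k + l)}"
    using Min_le Max_ge low_exp_I_poly[OF assms] high_exp_I_poly[OF assms]
    unfolding low_exp_def high_exp_def by (metis atLeastAtMost_iff subsetI)
qed

section \<open>Directed walks and potentials\<close>

definition walk_sum :: "'e list \<Rightarrow> 'e \<Rightarrow>\<^sub>0 int" where
  "walk_sum w = (\<Sum>e\<leftarrow>w. frag_of e)"

lemma walk_sum_simps [simp]:
  "walk_sum [] = 0" "walk_sum (e # w) = frag_of e + walk_sum w" "walk_sum (v @ w) = walk_sum v + walk_sum w"
  by (simp_all add: walk_sum_def)

lemma keys_walk_sum: "set w \<subseteq> A \<Longrightarrow> Poly_Mapping.keys (walk_sum w) \<subseteq> A"
proof (induction w)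
  case (Cons e w)
  then show ?case
    using Poly_Mapping.keys_add[of "frag_of e" "walk_sum w"] by auto
qed simp

lemma walk_sum_telescopes:
  assumes "pre_digraph.awalk H u w v"
  shows "frag_extend (\<lambda>e. \<phi> (head H e) - \<phi> (tail H e)) (walk_sum w) = \<phi> v - \<phi> u"
proof -
  have "pre_digraph.cas H u w v"
    using assms by (simp add: pre_digraph.awalk_def)
  then show ?thesis
    by (induction w arbitrary: u) (auto simp: pre_digraph.cas.simps frag_extend_add)
qed

text \<open>
  Subgroups of the additive group of a type; it applies both to ideals of Laurent polynomials
  and to subgroups of free Abelian groups.
\<close>

locale diff_closed =
  fixes N :: "'g::ab_group_add set"
  assumes zero: "0 \<in> N" and diff: "x \<in> N \<Longrightarrow> y \<in> N \<Longrightarrow> x - y \<in> N"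
begin

lemma add: "x \<in> N \<Longrightarrow> y \<in> N \<Longrightarrow> x + y \<in> N"
  using diff[of x "0 - y"] diff[OF zero, of y] by simp

end

text \<open>
  Modulo the closed walks, every arc is a difference of end point potentials.  The potential of
  a vertex is a walk leading there from \<open>r\<close>: prolonging it by an arc and returning to \<open>r\<close> gives a
  closed walk, and so does returning directly from the end of the arc.
\<close>

lemma (in wf_digraph) walk_potential:
  assumes N: "diff_closed N"
    and closed: "\<And>u w. awalk u w u \<Longrightarrow> w \<noteq> [] \<Longrightarrow> walk_sum w \<in> N"
    and reach: "\<And>v. v \<in> verts G \<Longrightarrow> r \<rightarrow>\<^sup>* v \<and> v \<rightarrow>\<^sup>* r"
  shows "\<exists>p. \<forall>e\<in>arcs G. frag_of e - (p (head G e) - p (tail G e)) \<in> N"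
proof -
  interpret diff_closed N by fact
  have "\<forall>v\<in>verts G. \<exists>w w'. awalk r w v \<and> awalk v w' r"
    using reach by (auto simp: reachable_awalk)
  then obtain a b where ab: "\<And>v. v \<in> verts G \<Longrightarrow> awalk r (a v) v \<and> awalk v (b v) r"
    by metis
  have "frag_of e - (walk_sum (a (head G e)) - walk_sum (a (tail G e))) \<in> N" if e: "e \<in> arcs G" for e
  proof -
    have v: "tail G e \<in> verts G" "head G e \<in> verts G"
      using e by auto
    let ?t = "tail G e" and ?h = "head G e"
    have "awalk r (a ?t @ [e] @ b ?h) r"
      using ab[OF v(1)] ab[OF v(2)] e arc_implies_awalk[OF e] by (meson awalk_appendI)
    then have "walk_sum (a ?t @ [e] @ b ?h) \<in> N"
      by (rule closed) simp
    moreover have "walk_sum (a ?h @ b ?h) \<in> N"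
    proof (cases "a ?h @ b ?h = []")
      case False
      have "awalk r (a ?h @ b ?h) r"
        using ab[OF v(2)] by (meson awalk_appendI)
      then show ?thesis
        using closed False by blast
    qed (simp only: walk_sum_simps zero)
    ultimately have "walk_sum (a ?t @ [e] @ b ?h) - walk_sum (a ?h @ b ?h) \<in> N"
      by (rule diff)
    then show ?thesis
      by (simp add: algebra_simps)
  qed
  then show ?thesis
    by (intro exI[of _ "\<lambda>v. walk_sum (a v)"]) simp
qed

section \<open>The relations of the Jacobian group of an I-graph\<close>

context
  fixes n k l :: nat
  assumes n: "n > 0"
begin

text \<open>
  Indices of vertices are residues, while exponents are integers; \<open>res\<close> translates, so that
  neighbours have the indices \<open>res (i + l)\<close> and \<open>res (i - l)\<close> without case distinctions.
\<close>

definition res :: "int \<Rightarrow> nat" where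
  "res q = nat (q mod int n)"

lemma res_less [simp]: "res q < n"
  using n by (simp add: res_def nat_less_iff)

lemma res_of_nat: "i < n \<Longrightarrow> res (int i) = i"
  by (simp add: res_def)

lemma int_res: "int (res q) = q mod int n"
  using n by (simp add: res_def)

lemma res_add_res [simp]: "res (int (res q) + c) = res (q + c)"
  and res_add_res_right [simp]: "res (c + int (res q)) = res (c + q)"
  and res_diff_res [simp]: "res (int (res q) - c) = res (q - c)"
  by (simp_all add: res_def[of "_ + _"] res_def[of "_ - _"] int_res mod_simps)

lemma res_int_add: "(i + j) mod n = res (int i + int j)"
  by (metis int_res nat_int of_nat_add of_nat_mod)

lemma add_mod_eq_iff: "i < n \<Longrightarrow> j < n \<Longrightarrow> (j + c) mod n = i \<longleftrightarrow> j = res (int i - int c)"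
proof -
  assume ij: "i < n" "j < n"
  have "(j + c) mod n = i \<longleftrightarrow> int ((j + c) mod n) = int i mod int n"
    using ij by simp
  also have "\<dots> \<longleftrightarrow> (int j + int c) mod int n = int i mod int n"
    by (simp add: of_nat_mod)
  also have "\<dots> \<longleftrightarrow> int j mod int n = (int i - int c) mod int n"
    by (simp add: mod_eq_dvd_iff algebra_simps)
  also have "\<dots> \<longleftrightarrow> j = res (int i - int c)"
    using ij int_res[of "int i - int c"] by auto
  finally show ?thesis .
qed

abbreviation H where "H \<equiv> bidirect (I_graph n k l)"

lemma arcs_H: "arcs H = (UU ` {0..<n} \<union> UV ` {0..<n} \<union> VV ` {0..<n}) \<times> UNIV"
  and verts_H: "verts H = U ` {0..<n} \<union> V ` {0..<n}"
  by (simp_all add: bidirect_def I_graph_def)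

lemma ends_H [simp]:
  "head H (UU i, True) = U (res (int i + int l))" "tail H (UU i, True) = U i"
  "head H (VV i, True) = V (res (int i + int k))" "tail H (VV i, True) = V i"
  "head H (UV i, True) = V i" "tail H (UV i, True) = U i"
  "tail H (e, False) = head H (e, True)" "head H (e, False) = tail H (e, True)"
  by (simp_all add: bidirect_def I_graph_def res_int_add)

lemma wf_H: "wf_digraph H"
proof
  fix e assume "e \<in> arcs H"
  then obtain e' d where e: "e = (e', d)" "e' \<in> UU ` {0..<n} \<union> UV ` {0..<n} \<union> VV ` {0..<n}"
    by (auto simp: arcs_H)
  then have "tail H (e', True) \<in> verts H \<and> head H (e', True) \<in> verts H"
    by (auto simp: verts_H)
  then show "tail H e \<in> verts H" "head H e \<in> verts H"
    by (cases d; simp add: e)+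
qed

lemma symmetric_H: "symmetric H"
  unfolding symmetric_conv
proof
  fix e assume "e \<in> arcs H"
  then have "(fst e, \<not> snd e) \<in> arcs H"
    by (auto simp: arcs_H)
  moreover have "tail H e = head H (fst e, \<not> snd e)" "head H e = tail H (fst e, \<not> snd e)"
    by (cases e; cases "snd e"; simp)+
  ultimately show "\<exists>e2\<in>arcs H. tail H e = head H e2 \<and> head H e = tail H e2"
    by blast
qed

lemma in_arcs_U:
  assumes "i < n"
  shows "{e \<in> arcs H. head H e = U i} = {(UU (res (int i - int l)), True), (UU i, False), (UV i, False)}"
proof -
  have mem: "(e, d) \<in> {e \<in> arcs H. head H e = U i} \<longleftrightarrow>
    (e, d) \<in> {(UU (res (int i - int l)), True), (UU i, False), (UV i, False)}" for e d
    using assms add_mod_eq_iff[OF assms, of _ l]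
    by (cases e; cases d) (auto simp: arcs_H res_int_add res_of_nat)
  show ?thesis
    by (rule Set.set_eqI) (simp only: split_paired_all mem)
qed

lemma in_arcs_V:
  assumes "i < n"
  shows "{e \<in> arcs H. head H e = V i} = {(VV (res (int i - int k)), True), (VV i, False), (UV i, True)}"
proof -
  have mem: "(e, d) \<in> {e \<in> arcs H. head H e = V i} \<longleftrightarrow>
    (e, d) \<in> {(VV (res (int i - int k)), True), (VV i, False), (UV i, True)}" for e d
    using assms add_mod_eq_iff[OF assms, of _ k]
    by (cases e; cases d) (auto simp: arcs_H res_int_add res_of_nat)
  show ?thesis
    by (rule Set.set_eqI) (simp only: split_paired_all mem)
qed

text \<open>
  Every vertex is the head of exactly three directed edges, also when the graph has multiple edges.
\<close>

lemma vertex_relations_I_graph: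
  "vertex_relations (I_graph n k l) =
     (\<lambda>i. frag_of (UU (res (int i - int l)), True) + frag_of (UU i, False) + frag_of (UV i, False)) ` {0..<n} \<union>
     (\<lambda>i. frag_of (VV (res (int i - int k)), True) + frag_of (VV i, False) + frag_of (UV i, True)) ` {0..<n}"
proof -
  have "vertex_relations (I_graph n k l) = (\<lambda>x. \<Sum>e\<in>{e \<in> arcs H. head H e = x}. frag_of e) ` verts H"
    unfolding vertex_relations_def Setcompr_eq_image by (simp add: bidirect_def)
  also have "\<dots> = (\<lambda>i. \<Sum>e\<in>{e \<in> arcs H. head H e = U i}. frag_of e) ` {0..<n} \<union>
     (\<lambda>i. \<Sum>e\<in>{e \<in> arcs H. head H e = V i}. frag_of e) ` {0..<n}"
    by (simp add: verts_H image_Un image_image)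
  also have "(\<lambda>i. \<Sum>e\<in>{e \<in> arcs H. head H e = U i}. frag_of e) ` {0..<n} =
     (\<lambda>i. frag_of (UU (res (int i - int l)), True) + frag_of (UU i, False) + frag_of (UV i, False)) ` {0..<n}"
    by (rule image_cong[OF refl]) (simp add: in_arcs_U add.assoc)
  also have "(\<lambda>i. \<Sum>e\<in>{e \<in> arcs H. head H e = V i}. frag_of e) ` {0..<n} =
     (\<lambda>i. frag_of (VV (res (int i - int k)), True) + frag_of (VV i, False) + frag_of (UV i, True)) ` {0..<n}"
    by (rule image_cong[OF refl]) (simp add: in_arcs_V add.assoc)
  finally show ?thesis .
qed

lemma cycle_relations_I_graph:
  "cycle_relations (I_graph n k l) = {walk_sum w | w. w \<noteq> [] \<and> (\<exists>x. pre_digraph.awalk H x w x)}"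
  by (simp add: cycle_relations_def walk_sum_def)

text \<open>
  By Bezout, \<open>k * x = l * y + 1\<close>.  Modulo \<open>n\<close> the negative steps \<open>- l * y\<close> can be replaced by
  \<open>(n - 1) * y\<close> positive ones, so \<open>i\<close> is reached by forward steps \<open>l\<close> on the outer and \<open>k\<close> on
  the inner vertices.
\<close>

lemma reachable_H:
  assumes kl: "gcd k l = 1" and "k > 0" and v: "v \<in> verts H"
  shows "U 0 \<rightarrow>\<^sup>*\<^bsub>H\<^esub> v \<and> v \<rightarrow>\<^sup>*\<^bsub>H\<^esub> U 0"
proof -
  interpret wf_digraph H by (rule wf_H)
  have step: "tail H e \<rightarrow>\<^sup>*\<^bsub>H\<^esub> head H e" if "e \<in> arcs H" for e
    using that arc_implies_awalk[OF that] by (auto simp: reachable_awalk)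
  have UU: "U i \<rightarrow>\<^sup>*\<^bsub>H\<^esub> U (res (int i + int l))" and VV: "V i \<rightarrow>\<^sup>*\<^bsub>H\<^esub> V (res (int i + int k))"
    and UV: "U i \<rightarrow>\<^sup>*\<^bsub>H\<^esub> V i" and VU: "V i \<rightarrow>\<^sup>*\<^bsub>H\<^esub> U i" if "i < n" for i
    using step[of "(UU i, True)"] step[of "(VV i, True)"] step[of "(UV i, True)"] step[of "(UV i, False)"] that
    by (simp_all add: arcs_H)
  have 1: "U 0 \<rightarrow>\<^sup>*\<^bsub>H\<^esub> U (res (int a * int l))" for a
  proof (induction a)
    case 0
    show ?case
      using n by (auto simp: res_def verts_H)
  next
    case (Suc a)
    from reachable_trans[OF Suc.IH UU[OF res_less]] show ?case
      by (simp add: algebra_simps)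
  qed
  have 2: "U 0 \<rightarrow>\<^sup>*\<^bsub>H\<^esub> V (res (int a * int l + int b * int k))" for a b
  proof (induction b)
    case 0
    from reachable_trans[OF 1 UV[OF res_less]] show ?case
      by simp
  next
    case (Suc b)
    from reachable_trans[OF Suc.IH VV[OF res_less]] show ?case
      by (simp add: algebra_simps)
  qed
  obtain x y where xy: "k * x = l * y + 1"
    using bezout_nat[of k l] kl \<open>k > 0\<close> by auto
  have 3: "U 0 \<rightarrow>\<^sup>*\<^bsub>H\<^esub> V i" if "i < n" for i
  proof -
    have "int ((n - 1) * y * i) * int l + int (x * i) * int k = int i * int n * int y * int l - int i * (int l * int y) + int i * int (k * x)"
      using n by (simp add: of_nat_diff algebra_simps)
    also have "\<dots> = int i + int n * (int i * int y * int l)"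
      unfolding xy by (simp add: algebra_simps)
    finally have "res (int ((n - 1) * y * i) * int l + int (x * i) * int k) = i"
      using that by (simp add: res_def)
    with 2[of "(n - 1) * y * i" "x * i"] show ?thesis by metis
  qed
  have "U 0 \<rightarrow>\<^sup>*\<^bsub>H\<^esub> v"
    using v 3 reachable_trans[OF 3 VU] by (auto simp: verts_H)
  then show ?thesis
    using symmetric_reachable[OF symmetric_H] by blast
qed

text \<open>
  In the cokernel of the Laplacian, the relation at \<open>U i\<close> expresses \<open>V i\<close> by the vertices \<open>U j\<close>;
  with \<open>U i\<close> represented by \<open>zpow i\<close>, this leaves no choice for \<open>V i\<close>.
\<close>

definition vertex_poly :: "I_vertex \<Rightarrow> laurent_poly" where
  "vertex_poly v = (case v of U i \<Rightarrow> zpow (int i) | V i \<Rightarrow> laplace l * zpow (int i))"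

definition boundary :: "(I_edge \<times> bool \<Rightarrow>\<^sub>0 int) \<Rightarrow> laurent_poly" where
  "boundary = frag_extend (\<lambda>e. vertex_poly (head H e) - vertex_poly (tail H e))"

lemma boundary_of: "boundary (frag_of e) = vertex_poly (head H e) - vertex_poly (tail H e)"
  and boundary_add: "boundary (x + y) = boundary x + boundary y"
  and boundary_diff: "boundary (x - y) = boundary x - boundary y"
  and boundary_zero: "boundary 0 = 0"
  by (simp_all add: boundary_def frag_extend_add frag_extend_diff)

lemma zpow_dvd_zpow_res: "zpow (int n) - 1 dvd zpow q - zpow (int (res q))"
  unfolding int_res using zpow_dvd_zpow_diff[of "int n" "q mod int n" "q div int n"] by simp

lemma aug_boundary: "aug (boundary x) = 0"
proof -
  have 1: "aug (vertex_poly v) = 1" for v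
    by (cases v) (simp_all add: vertex_poly_def aug_mult aug_laplace)
  have "Poly_Mapping.keys x \<subseteq> UNIV" by simp
  then show ?thesis
    by (induction x rule: frag_induction)
      (simp_all add: boundary_of boundary_diff boundary_zero aug_diff 1)
qed

context
  fixes m :: nat
  assumes pm: "palindromic_monic (I_poly k l) m"
begin

interpretation palindromic_monic "I_poly k l" m by (rule pm)

lemma ideal_diff_closed: "diff_closed (rel_ideal n)"
  by unfold_locales (auto simp: ideal_zero ideal_diff)

text \<open>
  At \<open>U i\<close> the boundary vanishes up to reduction of exponents modulo \<open>n\<close>, by the choice of
  \<open>vertex_poly\<close>.  At \<open>V i\<close> what remains is \<open>I_poly k l * zpow i\<close>.
\<close>

lemma boundary_vertex_relations:
  assumes "x \<in> vertex_relations (I_graph n k l)"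
  shows "boundary x \<in> rel_ideal n"
proof -
  interpret R: diff_closed "rel_ideal n" by (rule ideal_diff_closed)
  have res: "zpow q - zpow (int (res q)) \<in> rel_ideal n" for q
    by (rule ideal_dvd[OF zpow_dvd_zpow_res])
  from assms consider
    i where "i < n" "x = frag_of (UU (res (int i - int l)), True) + frag_of (UU i, False) + frag_of (UV i, False)"
  | i where "i < n" "x = frag_of (VV (res (int i - int k)), True) + frag_of (VV i, False) + frag_of (UV i, True)"
    unfolding vertex_relations_I_graph by auto
  then show ?thesis
  proof cases
    case 1
    have "boundary x = (zpow (int i - int l) - zpow (int (res (int i - int l)))) +
      (zpow (int i + int l) - zpow (int (res (int i + int l))))"
      using 1 by (simp add: boundary_of boundary_add vertex_poly_def res_of_nat laplace_mult_zpow)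
    then show ?thesis
      by (simp only: R.add res)
  next
    case 2
    have "boundary x = laplace l * (zpow (int i - int k) - zpow (int (res (int i - int k)))) +
      laplace l * (zpow (int i + int k) - zpow (int (res (int i + int k)))) + (laplace l * (laplace k * zpow (int i)) - zpow (int i))"
      using 2 unfolding laplace_mult_zpow[of k]
      by (simp add: boundary_of boundary_add vertex_poly_def res_of_nat algebra_simps)
    also have "laplace l * (laplace k * zpow (int i)) - zpow (int i) = I_poly k l * zpow (int i)"
      by (simp add: I_poly_laplace algebra_simps)
    finally show ?thesis
      by (simp only: R.add res ideal_mult ideal_P)
  qed
qed

lemma boundary_cycle_relations:
  assumes "x \<in> cycle_relations (I_graph n k l)"
  shows "boundary x = 0"
  using assms walk_sum_telescopes[of H _ _ _ "vertex_poly"]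
  by (auto simp: cycle_relations_I_graph boundary_def)

text \<open>
  A map \<open>\<beta>\<close> inverse to \<open>boundary\<close> modulo \<open>N\<close> is constructed: it sends \<open>zpow q\<close> to the potential of the
  vertex \<open>U (res q)\<close>.  The relations at the vertices \<open>U i\<close> make \<open>\<beta>\<close> send the polynomial of \<open>V i\<close> to
  the potential of \<open>V i\<close>; those at \<open>V i\<close> make it send multiples of \<open>I_poly k l\<close> into \<open>N\<close>.
  As arcs are differences of potentials modulo \<open>N\<close>, the composition \<open>\<beta> \<circ> boundary\<close> is the identity
  modulo \<open>N\<close>.
\<close>

lemma boundary_in_ideal_imp_relator:
  assumes kl: "gcd k l = 1" "k > 0"
    and N: "diff_closed N"
    and K1: "vertex_relations (I_graph n k l) \<subseteq> N"
    and K2: "cycle_relations (I_graph n k l) \<subseteq> N"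
    and x: "Poly_Mapping.keys x \<subseteq> arcs H"
    and Dx: "boundary x \<in> rel_ideal n"
  shows "x \<in> N"
proof -
  interpret wf_digraph H by (rule wf_H)
  interpret N: diff_closed N by (rule N)
  have "\<exists>p. \<forall>e\<in>arcs H. frag_of e - (p (head H e) - p (tail H e)) \<in> N"
  proof (rule walk_potential[OF N])
    show "walk_sum w \<in> N" if "awalk u w u" "w \<noteq> []" for u w
      using that K2 unfolding cycle_relations_I_graph by blast
    show "U 0 \<rightarrow>\<^sup>*\<^bsub>H\<^esub> v \<and> v \<rightarrow>\<^sup>*\<^bsub>H\<^esub> U 0" if "v \<in> verts H" for v
      by (rule reachable_H[OF kl that])
  qed
  then obtain p where p: "\<And>e. e \<in> arcs H \<Longrightarrow> frag_of e - (p (head H e) - p (tail H e)) \<in> N"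
    by blast
  define u where "u = (\<lambda>q. p (U (res q)))"
  define v where "v = (\<lambda>q. p (V (res q)))"
  define \<beta> where "\<beta> = frag_extend u"
  have \<beta>: "\<beta> (zpow q) = u q" "\<beta> (f + g) = \<beta> f + \<beta> g" "\<beta> (f - g) = \<beta> f - \<beta> g" "\<beta> 0 = 0" for q f g
    by (simp_all add: \<beta>_def frag_extend_add frag_extend_diff)
  have harmonic_u: "(u q - u (q - int l)) + (u q - u (q + int l)) + (u q - v q) \<in> N" for q
  proof -
    let ?i = "res q"
    have i: "?i \<in> {0..<n}"
      by simp
    have e: "(UU (res (int ?i - int l)), True) \<in> arcs H" "(UU ?i, False) \<in> arcs H" "(UV ?i, False) \<in> arcs H"
      by (auto simp: arcs_H)
    have "frag_of (UU (res (int ?i - int l)), True) + frag_of (UU ?i, False) + frag_of (UV ?i, False) \<in> N"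
      using K1 i unfolding vertex_relations_I_graph Un_subset_iff image_subset_iff by blast
    from N.diff[OF this N.add[OF N.add[OF p[OF e(1)] p[OF e(2)]] p[OF e(3)]]]
    show ?thesis
      by (simp add: u_def v_def res_of_nat)
  qed
  have harmonic_v: "(v q - v (q - int k)) + (v q - v (q + int k)) + (v q - u q) \<in> N" for q
  proof -
    let ?i = "res q"
    have i: "?i \<in> {0..<n}"
      by simp
    have e: "(VV (res (int ?i - int k)), True) \<in> arcs H" "(VV ?i, False) \<in> arcs H" "(UV ?i, True) \<in> arcs H"
      by (auto simp: arcs_H)
    have "frag_of (VV (res (int ?i - int k)), True) + frag_of (VV ?i, False) + frag_of (UV ?i, True) \<in> N"
      using K1 i unfolding vertex_relations_I_graph Un_subset_iff image_subset_iff by blast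
    from N.diff[OF this N.add[OF N.add[OF p[OF e(1)] p[OF e(2)]] p[OF e(3)]]]
    show ?thesis
      by (simp add: u_def v_def res_of_nat)
  qed
  have \<beta>_laplace: "\<beta> (laplace l * zpow q) - v q \<in> N" for q
  proof -
    have "\<beta> (laplace l * zpow q) - v q = (u q - u (q - int l)) + (u q - u (q + int l)) + (u q - v q)"
      by (simp only: laplace_mult_zpow \<beta>) (simp add: algebra_simps)
    then show ?thesis
      by (simp only: harmonic_u)
  qed
  have \<beta>_vertex: "\<beta> (vertex_poly w) - p w \<in> N" if "w \<in> verts H" for w
  proof (cases w)
    case (U i)
    then show ?thesis
      using that N.zero by (auto simp: verts_H vertex_poly_def \<beta> u_def res_of_nat)
  next
    case (V i)
    then show ?thesis
      using that \<beta>_laplace[of "int i"] by (auto simp: verts_H vertex_poly_def v_def res_of_nat)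
  qed
  have \<beta>_P: "\<beta> (b * I_poly k l) \<in> N" for b
  proof (induction b rule: laurent_induct)
    case (zpow q)
    let ?y = "\<lambda>q. laplace l * zpow q"
    let ?d = "\<lambda>q. \<beta> (?y q) - v q"
    have "zpow q * I_poly k l = laplace l * (laplace k * zpow q) - zpow q"
      by (simp add: I_poly_laplace algebra_simps)
    also have "\<dots> = ?y q + ?y q + ?y q - ?y (q - int k) - ?y (q + int k) - zpow q"
      unfolding laplace_mult_zpow[of k] by (simp only: distrib_left right_diff_distrib)
    finally have "\<beta> (zpow q * I_poly k l) = (?d q + ?d q + ?d q - ?d (q - int k) - ?d (q + int k)) +
      ((v q - v (q - int k)) + (v q - v (q + int k)) + (v q - u q))"
      by (simp only: \<beta>) (simp add: algebra_simps)
    then show ?case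
      by (simp only: N.add N.diff \<beta>_laplace harmonic_v)
  qed (simp_all add: \<beta> N.zero N.diff left_diff_distrib)
  have \<beta>_n: "\<beta> (a * (zpow (int n) - 1)) = 0" for a
  proof (induction a rule: laurent_induct)
    case (zpow q)
    have "\<beta> (zpow q * (zpow (int n) - 1)) = \<beta> (zpow (q + int n) - zpow q)"
      by (simp add: algebra_simps)
    then show ?case
      by (simp add: \<beta> u_def res_def)
  qed (simp_all add: \<beta> left_diff_distrib)
  have "\<beta> (boundary x) \<in> N"
    using Dx \<beta>_P by (auto simp: rel_ideal_def \<beta>(2) \<beta>_n)
  moreover have "x - \<beta> (boundary x) \<in> N"
    using x
  proof (induction x rule: frag_induction)
    case (one e)
    have "frag_of e - \<beta> (boundary (frag_of e)) = (frag_of e - (p (head H e) - p (tail H e))) -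
      ((\<beta> (vertex_poly (head H e)) - p (head H e)) - (\<beta> (vertex_poly (tail H e)) - p (tail H e)))"
      by (simp add: boundary_of \<beta>)
    also have "\<dots> \<in> N"
      using one by (intro N.diff p \<beta>_vertex) auto
    finally show ?case .
  next
    case (diff a b)
    then show ?case
      using N.diff[of "a - \<beta> (boundary a)" "b - \<beta> (boundary b)"]
      by (simp add: boundary_diff \<beta> algebra_simps)
  qed (simp_all add: boundary_zero \<beta> N.zero)
  ultimately show ?thesis
    using N.add by fastforce
qed

text \<open>
  Modulo the ideal, \<open>zpow q - 1\<close> is the boundary of a walk from \<open>U 0\<close> to \<open>U (res q)\<close>, and these
  differences span the polynomials of augmentation zero.
\<close>

lemma boundary_surj:
  assumes kl: "gcd k l = 1" "k > 0" and f: "aug f = 0"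
  obtains x where "Poly_Mapping.keys x \<subseteq> arcs H" "boundary x - f \<in> rel_ideal n"
proof -
  interpret wf_digraph H by (rule wf_H)
  have "\<exists>x. Poly_Mapping.keys x \<subseteq> arcs H \<and> boundary x - (f - of_int (aug f)) \<in> rel_ideal n" for f
  proof (induction f rule: laurent_induct)
    case zero
    show ?case
      by (intro exI[of _ 0]) (simp add: boundary_zero ideal_zero)
  next
    case (zpow q)
    have "U (res q) \<in> verts H"
      by (simp add: verts_H)
    then have "U 0 \<rightarrow>\<^sup>*\<^bsub>H\<^esub> U (res q)"
      using reachable_H[OF kl] by blast
    then obtain w where w: "awalk (U 0) w (U (res q))"
      by (auto simp: reachable_awalk)
    have "boundary (walk_sum w) = zpow (int (res q)) - 1"
      unfolding boundary_def walk_sum_telescopes[OF w] by (simp add: vertex_poly_def)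
    then have "boundary (walk_sum w) - (zpow q - of_int (aug (zpow q))) = 0 - (zpow q - zpow (int (res q)))"
      by simp
    also have "\<dots> \<in> rel_ideal n"
      by (intro ideal_diff ideal_zero ideal_dvd zpow_dvd_zpow_res)
    finally show ?case
      using keys_walk_sum[of w "arcs H"] w by blast
  next
    case (diff a b)
    then obtain x y where xy: "Poly_Mapping.keys x \<subseteq> arcs H" "boundary x - (a - of_int (aug a)) \<in> rel_ideal n"
      "Poly_Mapping.keys y \<subseteq> arcs H" "boundary y - (b - of_int (aug b)) \<in> rel_ideal n"
      by blast
    have "Poly_Mapping.keys (x - y) \<subseteq> arcs H"
      using xy Poly_Mapping.keys_diff[of x y] by blast
    moreover have "boundary (x - y) - (a - b - of_int (aug (a - b))) \<in> rel_ideal n"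
      using ideal_diff[OF xy(2) xy(4)] by (simp add: boundary_diff aug_diff algebra_simps)
    ultimately show ?case by blast
  qed
  from this[of f] show ?thesis
    using that f by auto
qed

end

end

section \<open>The isomorphism\<close>

lemma comm_group_vec: "comm_group (monoid_vec TYPE(int) s)"
proof (rule comm_groupI)
  fix x assume x: "x \<in> carrier (monoid_vec TYPE(int) s)"
  then have "- x + x = 0\<^sub>v s" "- x \<in> carrier_vec s"
    by (auto simp: monoid_vec_simps)
  then show "\<exists>y\<in>carrier (monoid_vec TYPE(int) s). y \<otimes>\<^bsub>monoid_vec TYPE(int) s\<^esub> x = \<one>\<^bsub>monoid_vec TYPE(int) s\<^esub>"
    unfolding monoid_vec_simps by blast
qed (auto simp: monoid_vec_simps comm_add_vec)

lemma subgroup_mat_image: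
  assumes "M \<in> carrier_mat s s"
  shows "subgroup ((\<lambda>v. M *\<^sub>v v) ` carrier_vec s) (monoid_vec TYPE(int) s)"
proof -
  let ?G = "monoid_vec TYPE(int) s"
  interpret G: comm_group ?G by (rule comm_group_vec)
  have "group_hom ?G ?G (\<lambda>v. M *\<^sub>v v)"
    using assms by (auto simp: group_hom_def group_hom_axioms_def hom_def monoid_vec_simps
        G.group_axioms mult_add_distrib_mat_vec)
  then show ?thesis
    using group_hom.img_is_subgroup by (fastforce simp: monoid_vec_simps)
qed

lemma subgroup_free_diff_closed:
  assumes "subgroup N (free_Abelian_group S)"
  shows "diff_closed N"
proof
  interpret subgroup N "free_Abelian_group S" by fact
  show "0 \<in> N" using one_closed by simp
  fix x y assume xy: "x \<in> N" "y \<in> N"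
  then have "Poly_Mapping.keys y \<subseteq> S"
    using mem_carrier[OF xy(2)] by simp
  then show "x - y \<in> N"
    using m_closed[OF xy(1) m_inv_closed[OF xy(2)]] by simp
qed

lemma relators_in_carrier:
  assumes "n > 0"
  shows "vertex_relations (I_graph n k l) \<union> cycle_relations (I_graph n k l)
    \<subseteq> carrier (free_Abelian_group (arcs (bidirect (I_graph n k l))))"
proof -
  let ?A = "arcs (bidirect (I_graph n k l))"
  have three: "Poly_Mapping.keys (frag_of a + frag_of b + frag_of c) \<subseteq> ?A" if "a \<in> ?A" "b \<in> ?A" "c \<in> ?A" for a b c
    using that by (intro order_trans[OF Poly_Mapping.keys_add] Un_least) auto
  have 1: "Poly_Mapping.keys x \<subseteq> ?A" if "x \<in> vertex_relations (I_graph n k l)" for x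
    using that assms unfolding vertex_relations_I_graph[OF assms]
    by (elim UnE imageE; simp only:; intro three) (simp_all add: arcs_H[OF assms] res_less[OF assms])
  have 2: "Poly_Mapping.keys x \<subseteq> ?A" if "x \<in> cycle_relations (I_graph n k l)" for x
  proof -
    obtain w y where w: "x = walk_sum w" "pre_digraph.awalk (bidirect (I_graph n k l)) y w y"
      using \<open>x \<in> cycle_relations (I_graph n k l)\<close> unfolding cycle_relations_I_graph[OF assms] by blast
    then have "set w \<subseteq> ?A"
      by (simp add: pre_digraph.awalk_def)
    then show ?thesis
      unfolding w(1) by (rule keys_walk_sum)
  qed
  show ?thesis
    using 1 2 by auto
qed

theorem corollary4p2:
  fixes n k l :: nat
  assumes "n > 0" and "k > 0" and "l > 0"
    and "gcd k l = 1"
    and "\<not> n dvd k" and "\<not> n dvd l"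
  shows "Jac (I_graph n k l) \<cong>
    torsion_subgroup (coker (companion_mat (I_poly k l) ^\<^sub>m n - 1\<^sub>m (2 * (k + l))))"
proof -
  note n = \<open>n > 0\<close>
  have pm: "palindromic_monic (I_poly k l) (k + l)"
    by (rule palindromic_monic_I_poly) fact+
  interpret palindromic_monic "I_poly k l" "k + l"
    by (rule pm)
  define M where "M = companion_mat (I_poly k l) ^\<^sub>m n - 1\<^sub>m (2 * (k + l))"
  define G where "G = monoid_vec TYPE(int) (2 * (k + l))"
  define Im where "Im = (\<lambda>v. M *\<^sub>v v) ` carrier_vec (2 * (k + l))"
  define A where "A = arcs (bidirect (I_graph n k l))"
  define F where "F = free_Abelian_group A"
  let ?rels = "vertex_relations (I_graph n k l) \<union> cycle_relations (I_graph n k l)"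
  let ?C = "coker M"
  have M: "M \<in> carrier_mat (2 * (k + l)) (2 * (k + l))"
    unfolding M_def by (rule minus_carrier_mat) simp
  have C: "?C = G Mod Im"
    using M by (simp add: coker_def G_def Im_def)
  interpret G: comm_group G
    unfolding G_def by (rule comm_group_vec)
  have "subgroup Im G"
    unfolding Im_def G_def by (rule subgroup_mat_image[OF M])
  then interpret Im: normal Im G
    by (simp add: G.normal_iff_subgroup)
  interpret C: group ?C
    unfolding C by (rule Im.factorgroup_is_group)
  interpret F: group F
    by (simp add: F_def)
  define cls where "cls f = Im #>\<^bsub>G\<^esub> window (f \<star> impulse)" for f
  have G_carrier: "window x \<in> carrier G" for x
    unfolding G_def monoid_vec_simps by (rule window_carrier)
  have cls_carrier: "cls f \<in> carrier ?C" for f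
    using Im.r_coset_hom_Mod G_carrier by (auto simp: C cls_def hom_def)
  have cls_add: "cls (f + g) = cls f \<otimes>\<^bsub>?C\<^esub> cls g" for f g
    using hom_mult[OF Im.r_coset_hom_Mod G_carrier G_carrier]
    by (simp add: C cls_def conv_add_left window_add G_def monoid_vec_simps)
  have cls_one: "cls f = \<one>\<^bsub>?C\<^esub> \<longleftrightarrow> f \<in> rel_ideal n" for f
  proof -
    have "cls f = \<one>\<^bsub>?C\<^esub> \<longleftrightarrow> window (f \<star> impulse) \<in> Im"
      using G.coset_join1[OF _ G_carrier Im.subgroup_axioms] G.coset_join2[OF G_carrier Im.subgroup_axioms]
      by (auto simp: C cls_def FactGroup_def)
    then show ?thesis
      unfolding Im_def M_def using impulse_window_in_image_iff[of f n] by simp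
  qed
  have cls_surj: "\<exists>f. X = cls f" if X: "X \<in> carrier ?C" for X
  proof -
    obtain v where v: "v \<in> carrier_vec (2 * (k + l))" "X = Im #>\<^bsub>G\<^esub> v"
      using X by (auto simp: C carrier_FactGroup G_def monoid_vec_simps)
    obtain f where "window (f \<star> impulse) = v"
      using window_surj[OF v(1)] by (auto simp: window_def)
    then show ?thesis
      using v by (auto simp: cls_def)
  qed
  \<comment> \<open>integer multiples in the cokernel correspond to integer multiples of Laurent polynomials\<close>
  have cls_pow: "cls f [^]\<^bsub>?C\<^esub> d = cls (of_nat d * f)" for f and d :: nat
  proof (induction d)
    case 0
    then show ?case
      using cls_one[of 0] ideal_zero by simp
  next
    case (Suc d)
    then show ?case
      using cls_add[of "of_nat d * f" f] by (simp add: algebra_simps)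
  qed
  have torsion: "(\<exists>d::nat. d > 0 \<and> cls f [^]\<^bsub>?C\<^esub> d = \<one>\<^bsub>?C\<^esub>) \<longleftrightarrow> aug f = 0" for f
  proof -
    have "aug f = 0 \<longleftrightarrow> (\<exists>d>0. of_nat d * f \<in> rel_ideal n)"
      by (rule torsion_iff[OF n aug_I_poly])
        (rule I_poly_harmonic[OF n \<open>gcd k l = 1\<close>])
    then show ?thesis
      by (simp add: cls_pow cls_one)
  qed
  \<comment> \<open>the isomorphism is induced by \<open>h\<close>: image and kernel remain to be determined\<close>
  define h where "h x = cls (boundary n k l x)" for x
  have h_hom: "h \<in> hom F ?C"
    by (auto simp: hom_def h_def cls_carrier F_def boundary_add[OF n] cls_add)
  then interpret h: group_hom F ?C h
    by unfold_locales
  have image: "h ` carrier F = {X \<in> carrier ?C. \<exists>d::nat. d > 0 \<and> X [^]\<^bsub>?C\<^esub> d = \<one>\<^bsub>?C\<^esub>}" (is "_ = ?T")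
  proof
    show "h ` carrier F \<subseteq> ?T"
      using torsion aug_boundary[OF n] by (auto simp: h_def cls_carrier)
    show "?T \<subseteq> h ` carrier F"
    proof
      fix X assume X: "X \<in> ?T"
      then obtain f where f: "X = cls f"
        using cls_surj by blast
      then have "aug f = 0"
        using X torsion by blast
      then obtain x where x: "Poly_Mapping.keys x \<subseteq> A" "boundary n k l x - f \<in> rel_ideal n"
        using boundary_surj[OF n pm \<open>gcd k l = 1\<close> \<open>k > 0\<close>] unfolding A_def by metis
      have "h x = cls (boundary n k l x - f) \<otimes>\<^bsub>?C\<^esub> cls f"
        unfolding cls_add[symmetric] h_def by simp
      also have "\<dots> = cls f"
        using x(2) cls_one cls_carrier by simp
      finally show "X \<in> h ` carrier F"
        using f x(1) by (auto simp: F_def)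
    qed
  qed
  have kernel: "kernel F ?C h = generate F ?rels"
  proof
    have rels: "?rels \<subseteq> carrier F"
      unfolding F_def A_def by (rule relators_in_carrier[OF n])
    have "?rels \<subseteq> kernel F ?C h"
    proof
      fix x assume x: "x \<in> ?rels"
      then have "boundary n k l x \<in> rel_ideal n"
        by (elim UnE) (simp_all only: boundary_vertex_relations[OF n pm] boundary_cycle_relations[OF n pm] ideal_zero)
      then show "x \<in> kernel F ?C h"
        using x rels by (auto simp: kernel_def h_def cls_one)
    qed
    then show "generate F ?rels \<subseteq> kernel F ?C h"
      using F.generate_subgroup_incl h.subgroup_kernel by blast
    show "kernel F ?C h \<subseteq> generate F ?rels"
    proof
      fix x assume "x \<in> kernel F ?C h"
      then have x: "Poly_Mapping.keys x \<subseteq> A" "boundary n k l x \<in> rel_ideal n"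
        by (auto simp: kernel_def h_def cls_one F_def)
      have "diff_closed (generate F ?rels)"
        using F.generate_is_subgroup[OF rels] unfolding F_def by (rule subgroup_free_diff_closed)
      then show "x \<in> generate F ?rels"
        using x unfolding A_def
        by (intro boundary_in_ideal_imp_relator[OF n pm \<open>gcd k l = 1\<close> \<open>k > 0\<close>]) (auto intro: generate.incl)
    qed
  qed
  have T: "torsion_subgroup ?C = ?C\<lparr>carrier := h ` carrier F\<rparr>"
    by (simp add: torsion_subgroup_def image)
  have "group (torsion_subgroup ?C)"
    unfolding T by (rule subgroup.subgroup_is_group[OF h.img_is_subgroup C.group_axioms])
  then have "group_hom F (torsion_subgroup ?C) h"
    using h_hom by (auto simp: group_hom_def group_hom_axioms_def F.group_axioms T hom_def)
  then have "F Mod kernel F (torsion_subgroup ?C) h \<cong> torsion_subgroup ?C"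
    by (rule group_hom.FactGroup_iso) (simp add: T)
  moreover have "kernel F (torsion_subgroup ?C) h = kernel F ?C h"
    by (simp add: kernel_def T)
  ultimately show ?thesis
    unfolding Jac_def Let_def A_def[symmetric] F_def[symmetric] M_def[symmetric] kernel[symmetric] by simp
qed

end
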